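(* There exists a $1$-consistent and $2$-robust algorithm for the MST problem under explorable uncertainty with predictions on instances that are prediction mandatory free and have a unique lower limit tree $T_L$ and a unique upper limit tree $T_U$ with $T_L=T_U$.
   Context: MST problem under explorable uncertainty with predictions: a connected (multi)graph $G=(V,E)$; each edge $e$ has unknown true weight $w_e\in\mathbb{R}_+$ and known uncertainty interval $I_e$, either open $(L_e,U_e)\ni w_e$ or trivial $\{w_e\}$ (then $L_e=U_e=w_e$). Querying $e$ reveals $w_e$. $Q\subseteq E$ is a feasible query set if some spanning tree is a minimum spanning tree for every weight assignment equal to $w_e$ on $Q$ and arbitrary in $I_e$ outside $Q$; $\mathrm{OPT}$ is a minimum-cardinality feasible query set. The algorithm queries adaptively until its query set $\mathrm{ALG}$ is feasible, and receives predictions $\hat w_e\in I_e$. $\rho$-competitive: $|\mathrm{ALG}|\le\rho|\mathrm{OPT}|$ on every instance (of the considered class); $\alpha$-consistent: $\alpha$-competitive when all predictions are correct; $\beta$-robust: $\beta$-competitive regardless of predictions. A lower limit tree $T_L$ is a minimum spanning tree for the weights $L_e+\epsilon$ with infinitesimally small $\epsilon>0$; an upper limit tree $T_U$ is a minimum spanning tree for the weights $U_e-\epsilon$. An edge is prediction mandatory if it belongs to every feasible query set under the hypothesis that all true values equal the predictions; an instance is prediction mandatory free if it has no prediction mandatory edge. *)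

theory Defs
  imports Complex_Main
begin

text \<open>The part of an instance that is known in advance: an undirected multigraph, the limits of
  the uncertainty intervals, and the predictions. The endpoint set of a loop is a singleton;
  parallel edges have the same endpoint set.\<close>

record ('v, 'e) mst_input =
  verts :: "'v set"
  edges :: "'e set"
  ends  :: "'e \<Rightarrow> 'v set"
  lower :: "'e \<Rightarrow> real"
  upper :: "'e \<Rightarrow> real"
  predicted :: "'e \<Rightarrow> real"


subsection \<open>Spanning trees\<close>

definition connects :: "('v, 'e) mst_input \<Rightarrow> 'e set \<Rightarrow> bool" where
  "connects X F \<longleftrightarrow>
     (\<forall>u\<in>verts X. \<forall>v\<in>verts X. (u, v) \<in> {(a, b). \<exists>e\<in>F. ends X e = {a, b}}\<^sup>*)"

text \<open>The edge \<open>es ! i\<close> joins \<open>vs ! i\<close> to its cyclic successor. Length 1 is a loop, length 2 a pair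
  of parallel edges.\<close>

definition is_cycle :: "('v, 'e) mst_input \<Rightarrow> 'v list \<Rightarrow> 'e list \<Rightarrow> bool" where
  "is_cycle X vs es \<longleftrightarrow>
     es \<noteq> [] \<and> length vs = length es \<and> distinct vs \<and> distinct es \<and>
     (\<forall>i < length es. ends X (es ! i) = {vs ! i, vs ! (Suc i mod length es)})"

definition spanning_tree :: "('v, 'e) mst_input \<Rightarrow> 'e set \<Rightarrow> bool" where
  "spanning_tree X T \<longleftrightarrow>
     T \<subseteq> edges X \<and> connects X T \<and> \<not> (\<exists>vs es. is_cycle X vs es \<and> set es \<subseteq> T)"

definition is_mst :: "('v, 'e) mst_input \<Rightarrow> ('e \<Rightarrow> real) \<Rightarrow> 'e set \<Rightarrow> bool" where
  "is_mst X c T \<longleftrightarrow> spanning_tree X T \<and> (\<forall>T'. spanning_tree X T' \<longrightarrow> sum c T \<le> sum c T')"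


subsection \<open>Uncertainty intervals and instances\<close>

definition trivial :: "('v, 'e) mst_input \<Rightarrow> 'e \<Rightarrow> bool" where
  "trivial X e \<longleftrightarrow> lower X e = upper X e"

definition interval :: "('v, 'e) mst_input \<Rightarrow> 'e \<Rightarrow> real set" where
  "interval X e = (if trivial X e then {lower X e} else {lower X e <..< upper X e})"

definition valid_input :: "('v, 'e) mst_input \<Rightarrow> bool" where
  "valid_input X \<longleftrightarrow>
     finite (verts X) \<and> verts X \<noteq> {} \<and> finite (edges X) \<and>
     (\<forall>e\<in>edges X. \<exists>u\<in>verts X. \<exists>v\<in>verts X. ends X e = {u, v}) \<and>
     connects X (edges X) \<and>
     (\<forall>e\<in>edges X. lower X e \<le> upper X e \<and> predicted X e \<in> interval X e)"

definition valid_weights :: "('v, 'e) mst_input \<Rightarrow> ('e \<Rightarrow> real) \<Rightarrow> bool" where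
  "valid_weights X w \<longleftrightarrow> (\<forall>e\<in>edges X. 0 \<le> w e \<and> w e \<in> interval X e)"


subsection \<open>Query sets\<close>

definition feasible :: "('v, 'e) mst_input \<Rightarrow> ('e \<Rightarrow> real) \<Rightarrow> 'e set \<Rightarrow> bool" where
  "feasible X w Q \<longleftrightarrow>
     Q \<subseteq> edges X \<and>
     (\<exists>T. spanning_tree X T \<and>
        (\<forall>w'. (\<forall>e\<in>Q. w' e = w e) \<and> (\<forall>e\<in>edges X - Q. w' e \<in> interval X e) \<longrightarrow> is_mst X w' T))"

definition opt :: "('v, 'e) mst_input \<Rightarrow> ('e \<Rightarrow> real) \<Rightarrow> nat" where
  "opt X w = (LEAST k. \<exists>Q. feasible X w Q \<and> card Q = k)"

definition prediction_mandatory :: "('v, 'e) mst_input \<Rightarrow> 'e \<Rightarrow> bool" where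
  "prediction_mandatory X e \<longleftrightarrow>
     e \<in> edges X \<and> (\<forall>Q. feasible X (predicted X) Q \<longrightarrow> e \<in> Q)"

definition prediction_mandatory_free :: "('v, 'e) mst_input \<Rightarrow> bool" where
  "prediction_mandatory_free X \<longleftrightarrow> \<not> (\<exists>e. prediction_mandatory X e)"


subsection \<open>Limit trees\<close>

text \<open>Only the non-trivial edges are perturbed: the weight of a trivial edge is known exactly, and
  shifting all edges by the same amount would not affect the minimum spanning trees.
  ``Infinitesimally small'' means for all sufficiently small positive values.\<close>

definition lower_limit_tree :: "('v, 'e) mst_input \<Rightarrow> 'e set \<Rightarrow> bool" where
  "lower_limit_tree X T \<longleftrightarrow>
     (\<forall>\<^sub>F \<epsilon> in at_right 0.
        is_mst X (\<lambda>e. if trivial X e then lower X e else lower X e + \<epsilon>) T)"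

definition upper_limit_tree :: "('v, 'e) mst_input \<Rightarrow> 'e set \<Rightarrow> bool" where
  "upper_limit_tree X T \<longleftrightarrow>
     (\<forall>\<^sub>F \<epsilon> in at_right 0.
        is_mst X (\<lambda>e. if trivial X e then upper X e else upper X e - \<epsilon>) T)"

definition unique_equal_limit_trees :: "('v, 'e) mst_input \<Rightarrow> bool" where
  "unique_equal_limit_trees X \<longleftrightarrow>
     (\<exists>T. {T'. lower_limit_tree X T'} = {T} \<and> {T'. upper_limit_tree X T'} = {T})"


subsection \<open>Adaptive algorithms\<close>

text \<open>A (deterministic) algorithm sees the known input and the weights revealed so far; it returns
  the next edge to query, or \<open>None\<close> to stop.\<close>

type_synonym ('v, 'e) query_algorithm =
  "('v, 'e) mst_input \<Rightarrow> ('e \<rightharpoonup> real) \<Rightarrow> 'e option"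

definition revealed :: "('e \<Rightarrow> real) \<Rightarrow> 'e set \<Rightarrow> ('e \<rightharpoonup> real)" where
  "revealed w Q = (\<lambda>e. if e \<in> Q then Some (w e) else None)"

text \<open>\<open>queried A X w Q\<close>: at some point of the run of \<open>A\<close> on \<open>X\<close> with true weights \<open>w\<close>, exactly the
  edges in \<open>Q\<close> have been queried. A run is stuck when it queries a non-edge or repeats a query;
  it then has no final query set.\<close>

inductive queried ::
  "('v, 'e) query_algorithm \<Rightarrow> ('v, 'e) mst_input \<Rightarrow> ('e \<Rightarrow> real) \<Rightarrow> 'e set \<Rightarrow> bool"
  for A X w where
  start: "queried A X w {}"
| query: "queried A X w Q \<Longrightarrow> A X (revealed w Q) = Some e \<Longrightarrow> e \<in> edges X - Q
            \<Longrightarrow> queried A X w (insert e Q)"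

definition final_queries ::
  "('v, 'e) query_algorithm \<Rightarrow> ('v, 'e) mst_input \<Rightarrow> ('e \<Rightarrow> real) \<Rightarrow> 'e set \<Rightarrow> bool" where
  "final_queries A X w Q \<longleftrightarrow> queried A X w Q \<and> A X (revealed w Q) = None"

definition competitive_on ::
  "('v, 'e) query_algorithm \<Rightarrow> real \<Rightarrow> ('v, 'e) mst_input \<Rightarrow> ('e \<Rightarrow> real) \<Rightarrow> bool" where
  "competitive_on A \<rho> X w \<longleftrightarrow>
     (\<exists>Q. final_queries A X w Q \<and> feasible X w Q \<and> real (card Q) \<le> \<rho> * real (opt X w))"

definition consistent ::
  "('v, 'e) query_algorithm \<Rightarrow> ('v, 'e) mst_input set \<Rightarrow> real \<Rightarrow> bool" where
  "consistent A C \<alpha> \<longleftrightarrow>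
     (\<forall>X\<in>C. \<forall>w. valid_weights X w \<and> (\<forall>e\<in>edges X. predicted X e = w e) \<longrightarrow>
        competitive_on A \<alpha> X w)"

definition robust ::
  "('v, 'e) query_algorithm \<Rightarrow> ('v, 'e) mst_input set \<Rightarrow> real \<Rightarrow> bool" where
  "robust A C \<beta> \<longleftrightarrow> (\<forall>X\<in>C. \<forall>w. valid_weights X w \<longrightarrow> competitive_on A \<beta> X w)"

end

theory Submission
  imports Defs
begin

text \<open>Call a tree edge \<open>a\<close> and a non-tree edge \<open>b\<close> on whose tree cycle \<open>a\<close> lies overlapping if their
  intervals intersect. If no edge is prediction mandatory, then a correct prediction of either
  edge of an overlapping pair already settles the order of the two weights. Hence, as long as the
  predictions turn out correct, it suffices to query a minimum vertex cover of the bipartite graph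
  of overlapping pairs. By Koenig's theorem every covered edge \<open>x\<close> has a private partner \<open>h x\<close>
  outside the cover, and in a suitable order every queried \<open>x\<close> forms with \<open>h x\<close> a witness set, that
  is, a set that meets every feasible query set. So correct predictions lead to an optimal number of
  queries. After the first wrong prediction the partners of the queried edges are queried too, and
  then further disjoint witness sets of size at most two, which any uncertified instance offers;
  this costs at most twice the optimum. Spanning trees enter only through the symmetric exchange
  property.\<close>

section \<open>Spanning trees and the symmetric exchange property\<close>

text \<open>The obstacle is that a feasible query set may certify a spanning tree other than
  \<open>T\<close>, so a witness set has to be justified against every tree \<open>T'\<close> that
  could become certified. Certification is therefore reduced to one inequality per swap, and an
  exchange between \<open>T\<close> and \<open>T'\<close> yields a swap whose inequality fails. Open
  intervals matter here: a newly revealed weight of a non-trivial edge never attains an old limit,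
  so the critical ties can only come from edges that were determined before. Lower bounds found at
  different times add up because \<open>witness\<close> refers to all feasible query sets, so a
  single optimal set meets every member of a disjoint family. An algorithm has no memory besides the
  revealed weights; the stage it is in must be readable from that partial map, which is why the
  stages appear as the predicates \<open>on_track\<close> and \<open>off_track\<close>.\<close>

definition conn :: "('v, 'e) mst_input \<Rightarrow> 'e set \<Rightarrow> ('v \<times> 'v) set" where
  "conn X F = {(a, b). \<exists>e\<in>F. ends X e = {a, b}}\<^sup>*"

text \<open>Membership of \<open>e\<close> in the closure of \<open>F\<close> in the graphic
  matroid; a loop lies in every closure since \<open>conn\<close> is reflexive.\<close>

definition spans :: "('v, 'e) mst_input \<Rightarrow> 'e set \<Rightarrow> 'e \<Rightarrow> bool" where
  "spans X F e \<longleftrightarrow> (\<forall>u v. ends X e = {u, v} \<longrightarrow> (u, v) \<in> conn X F)"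

lemma conn_refl [simp]: "(u, u) \<in> conn X F"
  by (simp add: conn_def)

lemma conn_trans: "(u, v) \<in> conn X F \<Longrightarrow> (v, x) \<in> conn X F \<Longrightarrow> (u, x) \<in> conn X F"
  unfolding conn_def by (rule rtrancl_trans)

lemma conn_sym: "(u, v) \<in> conn X F \<Longrightarrow> (v, u) \<in> conn X F"
proof -
  have "sym {(a, b). \<exists>e\<in>F. ends X e = {a, b}}"
    by (auto intro!: symI simp: insert_commute)
  then show "(u, v) \<in> conn X F \<Longrightarrow> (v, u) \<in> conn X F"
    unfolding conn_def by (meson sym_rtrancl symD)
qed

lemma conn_edge: "e \<in> F \<Longrightarrow> ends X e = {u, v} \<Longrightarrow> (u, v) \<in> conn X F"
  unfolding conn_def by (intro r_into_rtrancl) auto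

lemma conn_le_spans: "(\<And>e. e \<in> F \<Longrightarrow> spans X G e) \<Longrightarrow> conn X F \<subseteq> conn X G"
proof
  fix p assume *: "\<And>e. e \<in> F \<Longrightarrow> spans X G e" and "p \<in> conn X F"
  then obtain u v where p: "p = (u, v)" "(u, v) \<in> {(a, b). \<exists>e\<in>F. ends X e = {a, b}}\<^sup>*"
    unfolding conn_def by (cases p) auto
  from p(2) have "(u, v) \<in> conn X G"
  proof (induction rule: rtrancl_induct)
    case (step y z)
    then obtain e where "e \<in> F" "ends X e = {y, z}" by auto
    then have "(y, z) \<in> conn X G" using * by (simp add: spans_def)
    then show ?case using step.IH conn_trans by metis
  qed simp
  then show "p \<in> conn X G" using p by simp
qed

lemma spans_self: "e \<in> F \<Longrightarrow> spans X F e"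
  by (simp add: spans_def conn_edge)

lemma spans_insert_remove: "spans X (insert f (F - {e})) e \<Longrightarrow> x \<in> F \<Longrightarrow> spans X (insert f (F - {e})) x"
  by (cases "x = e") (simp_all add: spans_self)

lemma spans_trans: "spans X F e \<Longrightarrow> (\<And>x. x \<in> F \<Longrightarrow> spans X G x) \<Longrightarrow> spans X G e"
  unfolding spans_def[of X F] using conn_le_spans[of F X G] by (auto simp: spans_def)

lemma spans_mono: "spans X F e \<Longrightarrow> F \<subseteq> G \<Longrightarrow> spans X G e"
  by (erule spans_trans) (auto intro: spans_self)

lemma conn_insert:
  assumes "(u, v) \<in> conn X (insert f F)"
  shows "(u, v) \<in> conn X F \<or> (\<exists>c d. ends X f = {c, d} \<and> (u, c) \<in> conn X F \<and> (d, v) \<in> conn X F)"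
  using assms unfolding conn_def[of X "insert f F"]
proof (induction rule: rtrancl_induct)
  case (step y z)
  show ?case
  proof (cases "\<exists>e\<in>F. ends X e = {y, z}")
    case True
    then have "(y, z) \<in> conn X F" using conn_edge by metis
    then show ?thesis using step.IH conn_trans by metis
  next
    case False
    then have f: "ends X f = {y, z}" using step.hyps by auto
    then show ?thesis using step.IH conn_refl by (metis doubleton_eq_iff)
  qed
qed simp

text \<open>The Mac Lane-Steinitz exchange axiom: a walk joining the ends of \<open>e\<close> must
  use \<open>f\<close>, and its pieces on either side of \<open>f\<close> together with
  \<open>e\<close> join the ends of \<open>f\<close>.\<close>

lemma spans_exchange:
  assumes "spans X (insert f F) e" "\<not> spans X F e"
  shows "spans X (insert e F) f"
proof -
  obtain u v where e: "ends X e = {u, v}" "(u, v) \<notin> conn X F"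
    using assms(2) by (auto simp: spans_def)
  then have "(u, v) \<in> conn X (insert f F)" using assms(1) by (auto simp: spans_def)
  from conn_insert[OF this] e(2) obtain c d where cd:
    "ends X f = {c, d}" "(u, c) \<in> conn X F" "(d, v) \<in> conn X F" by blast
  have sub: "conn X F \<subseteq> conn X (insert e F)"
    by (rule conn_le_spans) (simp add: spans_self)
  have "(u, v) \<in> conn X (insert e F)" using e(1) by (auto intro: conn_edge[of e])
  then have 1: "(c, d) \<in> conn X (insert e F)"
    using cd sub conn_sym conn_trans by (metis subsetD)
  show ?thesis unfolding spans_def
  proof (intro allI impI)
    fix a b assume "ends X f = {a, b}"
    then have "a = c \<and> b = d \<or> a = d \<and> b = c" using cd(1) by (metis doubleton_eq_iff)
    then show "(a, b) \<in> conn X (insert e F)" using 1 conn_sym by metis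
  qed
qed

section \<open>Cycles and dependent edges\<close>

lemma cycle_spans:
  assumes "is_cycle X vs es"
  shows "spans X (set es - {es ! 0}) (es ! 0)"
proof -
  let ?n = "length es" and ?F = "set es - {es ! 0}"
  have c: "?n > 0" "length vs = ?n" "distinct es"
    "\<And>i. i < ?n \<Longrightarrow> ends X (es ! i) = {vs ! i, vs ! (Suc i mod ?n)}"
    using assms by (auto simp: is_cycle_def)
  have step: "(vs ! i, vs ! (Suc i mod ?n)) \<in> conn X ?F" if "0 < i" "i < ?n" for i
  proof -
    have "es ! i \<in> ?F" using that c by (auto simp: nth_eq_iff_index_eq)
    then show ?thesis using c(4)[OF that(2)] by (rule conn_edge)
  qed
  \<comment> \<open>The start \<open>1 mod ?n\<close> also covers a loop, where the remaining path
    is empty and begins and ends in \<open>vs ! 0\<close>.\<close>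
  have path: "(vs ! (1 mod ?n), vs ! (Suc i mod ?n)) \<in> conn X ?F" if "i < ?n" for i
    using that
  proof (induction i)
    case (Suc i)
    then have "(vs ! (1 mod ?n), vs ! (Suc i mod ?n)) \<in> conn X ?F" by simp
    moreover have "(vs ! Suc i, vs ! (Suc (Suc i) mod ?n)) \<in> conn X ?F"
      using step[of "Suc i"] Suc.prems by simp
    ultimately show ?case using Suc.prems conn_trans by (metis mod_less)
  qed simp
  have "(vs ! (1 mod ?n), vs ! 0) \<in> conn X ?F"
    using path[of "?n - 1"] c(1) by simp
  moreover have "ends X (es ! 0) = {vs ! 0, vs ! (1 mod ?n)}" using c(4)[OF c(1)] by simp
  ultimately show ?thesis unfolding spans_def using conn_sym
    by (metis doubleton_eq_iff)
qed

text \<open>When a walk returns to a vertex of the path built so far, the path is cut there.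
  Otherwise it is extended, and the new edge is new because its end \<open>z\<close> is not an end
  of any earlier edge.\<close>

lemma conn_simple_path:
  assumes "(u, v) \<in> conn X F"
  shows "\<exists>vs es. length vs = Suc (length es) \<and> distinct vs \<and> distinct es \<and> set es \<subseteq> F \<and>
    vs ! 0 = u \<and> vs ! length es = v \<and> (\<forall>i < length es. ends X (es ! i) = {vs ! i, vs ! Suc i})"
  using assms unfolding conn_def
proof (induction rule: rtrancl_induct)
  case base
  show ?case by (rule exI[of _ "[u]"], rule exI[of _ "[]"]) simp
next
  case (step y z)
  from step.IH obtain vs es where p: "length vs = Suc (length es)" "distinct vs" "distinct es" "set es \<subseteq> F"
    "vs ! 0 = u" "vs ! length es = y" "\<forall>i < length es. ends X (es ! i) = {vs ! i, vs ! Suc i}"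
    by (elim exE conjE)
  obtain e where e: "e \<in> F" "ends X e = {y, z}" using step.hyps by auto
  show ?case
  proof (cases "z \<in> set vs")
    case True
    then obtain k where k: "k < length vs" "vs ! k = z" by (auto simp: in_set_conv_nth)
    have "set (take k es) \<subseteq> F" using p(4) set_take_subset by fast
    moreover have l: "length (take k es) = k" using k p(1) by simp
    moreover have "length (take (Suc k) vs) = Suc k" using k by simp
    moreover have "\<forall>i<k. ends X (take k es ! i) = {take (Suc k) vs ! i, take (Suc k) vs ! Suc i}"
      using p(7) k p(1) by simp
    moreover have "take (Suc k) vs ! 0 = u" "take (Suc k) vs ! k = z" using p(5) k(2) by simp_all
    ultimately show ?thesis using p(2,3)
      by (intro exI[of _ "take (Suc k) vs"] exI[of _ "take k es"]) (simp only: distinct_take simp_thms)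
  next
    case False
    have "e \<notin> set es"
    proof
      assume "e \<in> set es"
      then obtain i where i: "i < length es" "es ! i = e" by (auto simp: in_set_conv_nth)
      then have "{y, z} = {vs ! i, vs ! Suc i}" using p(7) e(2) by metis
      moreover have "vs ! i \<in> set vs" "vs ! Suc i \<in> set vs" using i p(1) by auto
      ultimately show False using False by (metis doubleton_eq_iff)
    qed
    moreover have "ends X ((es @ [e]) ! i) = {(vs @ [z]) ! i, (vs @ [z]) ! Suc i}"
      if "i < Suc (length es)" for i
    proof (cases "i = length es")
      case False
      then show ?thesis using that p(1) p(7)[rule_format, of i] by (simp add: nth_append)
    qed (use p(1,6) e(2) in \<open>simp add: nth_append\<close>)
    moreover have "(vs @ [z]) ! 0 = u" "(vs @ [z]) ! length (es @ [e]) = z"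
      using p(1,5) by (simp_all add: nth_append)
    ultimately show ?thesis using p(1-4) e(1) False
      by (intro exI[of _ "vs @ [z]"] exI[of _ "es @ [e]"]) simp
  qed
qed

lemma spans_cycle:
  assumes "spans X (F - {e}) e" "e \<in> F" "ends X e = {u, v}"
  shows "\<exists>vs es. is_cycle X vs es \<and> set es \<subseteq> F"
proof -
  have "(u, v) \<in> conn X (F - {e})" using assms by (simp add: spans_def)
  from conn_simple_path[OF this] obtain vs es where p: "length vs = Suc (length es)" "distinct vs"
    "distinct es" "set es \<subseteq> F - {e}" "vs ! 0 = u" "vs ! length es = v"
    "\<forall>i < length es. ends X (es ! i) = {vs ! i, vs ! Suc i}"
    by (elim exE conjE)
  have "ends X ((es @ [e]) ! i) = {vs ! i, vs ! (Suc i mod Suc (length es))}"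
    if i: "i < Suc (length es)" for i
  proof (cases "i = length es")
    case False
    then have "i < length es" using i by simp
    then show ?thesis using p(7) by (simp add: nth_append)
  qed (use assms(3) p in auto)
  then have "is_cycle X vs (es @ [e])" unfolding is_cycle_def
    using p by auto
  then show ?thesis using p assms(2) by (intro exI[of _ vs] exI[of _ "es @ [e]"]) auto
qed

text \<open>For a spanning tree \<open>T\<close>: \<open>e\<close> lies on the cycle that
  \<open>f\<close> closes with \<open>T\<close>, or equally, \<open>f\<close> crosses the cut left
  by removing \<open>e\<close>. Mentioning only the exchanged tree spares the later arguments both
  cycles and cuts.\<close>

definition swap :: "('v, 'e) mst_input \<Rightarrow> 'e set \<Rightarrow> 'e \<Rightarrow> 'e \<Rightarrow> bool" where
  "swap X T e f \<longleftrightarrow> e \<in> T \<and> f \<notin> T \<and> spanning_tree X (insert f (T - {e}))"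

locale uncertain_mst =
  fixes X :: "('v, 'e) mst_input"
  assumes valid: "valid_input X"
begin

lemma finite_edges [simp]: "finite (edges X)"
  using valid by (simp add: valid_input_def)

lemma connects_iff_spans: "connects X F \<longleftrightarrow> (\<forall>e\<in>edges X. spans X F e)"
proof
  assume F: "connects X F"
  show "\<forall>e\<in>edges X. spans X F e" unfolding spans_def
  proof (intro ballI allI impI)
    fix e u v assume e: "e \<in> edges X" "ends X e = {u, v}"
    obtain u' v' where uv: "u' \<in> verts X" "v' \<in> verts X" "ends X e = {u', v'}"
      using valid e(1) unfolding valid_input_def by metis
    then have "u \<in> verts X" "v \<in> verts X" using e by (auto simp: doubleton_eq_iff)
    then show "(u, v) \<in> conn X F" using F by (simp add: connects_def conn_def)
  qed
next
  assume "\<forall>e\<in>edges X. spans X F e"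
  then have "conn X (edges X) \<subseteq> conn X F" by (intro conn_le_spans) simp
  moreover have "connects X (edges X)" using valid by (simp add: valid_input_def)
  ultimately show "connects X F" unfolding connects_def conn_def by blast
qed

text \<open>Replaces the graph-theoretic definition by that of a matroid basis, spanning and
  independent; cycles do not occur after this point.\<close>

lemma spanning_tree_iff:
  "spanning_tree X T \<longleftrightarrow>
    T \<subseteq> edges X \<and> (\<forall>e\<in>edges X. spans X T e) \<and> (\<forall>e\<in>T. \<not> spans X (T - {e}) e)"
proof -
  have "(\<exists>vs es. is_cycle X vs es \<and> set es \<subseteq> T) \<longleftrightarrow> (\<exists>e\<in>T. spans X (T - {e}) e)"
    if T: "T \<subseteq> edges X"
  proof
    assume "\<exists>vs es. is_cycle X vs es \<and> set es \<subseteq> T"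
    then obtain vs es where c: "is_cycle X vs es" "set es \<subseteq> T" by blast
    then have "es ! 0 \<in> T" by (auto simp: is_cycle_def)
    moreover have "spans X (T - {es ! 0}) (es ! 0)"
      using cycle_spans[OF c(1)] by (rule spans_mono) (use c in auto)
    ultimately show "\<exists>e\<in>T. spans X (T - {e}) e" by blast
  next
    assume "\<exists>e\<in>T. spans X (T - {e}) e"
    then obtain e where e: "e \<in> T" "spans X (T - {e}) e" by blast
    moreover obtain u v where "ends X e = {u, v}"
      using valid e T unfolding valid_input_def by (metis subsetD)
    ultimately show "\<exists>vs es. is_cycle X vs es \<and> set es \<subseteq> T" by (intro spans_cycle)
  qed
  then show ?thesis unfolding spanning_tree_def connects_iff_spans by blast
qed

lemma spanning_tree_finite: "spanning_tree X T \<Longrightarrow> finite T"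
  unfolding spanning_tree_def using finite_edges finite_subset by metis

lemma finite_spanning_trees: "finite {T. spanning_tree X T}"
  by (rule finite_subset[of _ "Pow (edges X)"]) (auto simp: spanning_tree_def)

lemma spanning_tree_exists: "\<exists>T. spanning_tree X T"
proof -
  let ?P = "\<lambda>F. F \<subseteq> edges X \<and> (\<forall>e\<in>edges X. spans X F e)"
  have "?P (edges X)" by (simp add: spans_self)
  from ex_has_least_nat[of ?P, OF this, of card] obtain T where
    T: "?P T" "\<And>F. ?P F \<Longrightarrow> card T \<le> card F" by blast
  have "\<not> spans X (T - {e}) e" if e: "e \<in> T" for e
  proof
    assume "spans X (T - {e}) e"
    then have "spans X (T - {e}) x" if "x \<in> T" for x
      using that by (cases "x = e") (auto intro: spans_self)
    then have "?P (T - {e})" using T(1) spans_trans[of X T] by blast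
    moreover have "card (T - {e}) < card T"
      using e T(1) finite_edges by (meson card_Diff1_less finite_subset)
    ultimately show False using T(2)[of "T - {e}"] by linarith
  qed
  then show ?thesis using T(1) spanning_tree_iff by blast
qed

text \<open>A smallest \<open>C\<close> inside \<open>T'\<close> that spans \<open>e\<close> forms
  with \<open>e\<close> the cycle that \<open>e\<close> closes with \<open>T'\<close>. Some
  \<open>f\<close> in \<open>C\<close> escapes the closure of \<open>T - {e}\<close>, since
  otherwise \<open>T - {e}\<close> would span \<open>e\<close>; this \<open>f\<close> can replace
  \<open>e\<close> in \<open>T\<close>. Minimality of \<open>C\<close> makes \<open>f\<close>
  indispensable for \<open>e\<close>, so \<open>e\<close> can replace \<open>f\<close> in
  \<open>T'\<close>.\<close>

lemma symmetric_exchange: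
  assumes T: "spanning_tree X T" and T': "spanning_tree X T'" and e: "e \<in> T" "e \<notin> T'"
  shows "\<exists>f. swap X T e f \<and> swap X T' f e"
proof -
  note T = T[unfolded spanning_tree_iff] and T' = T'[unfolded spanning_tree_iff]
  have "spans X T' e" using T T' e by blast
  from ex_has_least_nat[of "\<lambda>C. C \<subseteq> T' \<and> spans X C e" T' card] this obtain C where
    C: "C \<subseteq> T'" "spans X C e" "\<And>D. D \<subseteq> T' \<Longrightarrow> spans X D e \<Longrightarrow> card C \<le> card D" by blast
  have e_min: "\<not> spans X (T - {e}) e" using T e by blast
  obtain f where f: "f \<in> C" "\<not> spans X (T - {e}) f"
    using spans_trans[OF C(2), of "T - {e}"] e_min by blast
  have "finite C" using C(1) T' finite_edges by (meson finite_subset)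
  then have "card (C - {f}) < card C" using f by (meson card_Diff1_less)
  then have f_min: "\<not> spans X (C - {f}) e" using C(1) C(3)[of "C - {f}"] by (meson Diff_subset not_le order_trans)
  have ins: "insert e (T - {e}) = T" "insert f (C - {f}) = C" "f \<noteq> e" "f \<in> T'"
    using e f C(1) by auto
  have fT: "f \<notin> T" using f(2) ins spans_self by (metis DiffI singletonD)
  have fE: "f \<in> edges X" and eE: "e \<in> edges X" using ins T T' e by auto
  have e_sp: "spans X (insert f (T - {e})) e"
    by (rule spans_exchange) (use ins f T fE in auto)
  have f_spC: "spans X (insert e (C - {f})) f"
    by (rule spans_exchange) (use ins f_min C in auto)
  then have f_sp: "spans X (insert e (T' - {f})) f"
    by (rule spans_mono) (use C in auto)
  have "spanning_tree X (insert f (T - {e}))"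
    unfolding spanning_tree_iff
  proof (intro conjI ballI)
    fix x assume "x \<in> edges X"
    then have "spans X T x" using T by blast
    then show "spans X (insert f (T - {e})) x"
      by (rule spans_trans) (use e_sp in \<open>auto intro: spans_insert_remove\<close>)
  next
    fix x assume x: "x \<in> insert f (T - {e})"
    show "\<not> spans X (insert f (T - {e}) - {x}) x"
    proof (cases "x = f")
      case True
      then show ?thesis using f(2) fT by (simp add: Diff_insert_absorb)
    next
      case False
      then have x': "x \<in> T" "x \<noteq> e" using x by auto
      have "insert f (T - {e}) - {x} = insert f (T - {e} - {x})" using False by auto
      moreover have "\<not> spans X (T - {e} - {x}) x"
        using T x' spans_mono[of X "T - {e} - {x}" x "T - {x}"] by auto
      moreover have "insert x (T - {e} - {x}) = T - {e}" using x' by auto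
      ultimately show ?thesis using f(2) spans_exchange by metis
    qed
  qed (use T fE in auto)
  moreover have "spanning_tree X (insert e (T' - {f}))"
    unfolding spanning_tree_iff
  proof (intro conjI ballI)
    fix x assume "x \<in> edges X"
    then have "spans X T' x" using T' by blast
    then show "spans X (insert e (T' - {f})) x"
      by (rule spans_trans) (use f_sp in \<open>auto intro: spans_insert_remove\<close>)
  next
    fix x assume x: "x \<in> insert e (T' - {f})"
    have e_notin: "\<not> spans X (T' - {f}) e"
    proof
      assume *: "spans X (T' - {f}) e"
      have "spans X (T' - {f}) f"
        by (rule spans_trans[OF f_spC]) (use * C(1) in \<open>auto intro: spans_self\<close>)
      then show False using T' ins by blast
    qed
    show "\<not> spans X (insert e (T' - {f}) - {x}) x"
    proof (cases "x = e")
      case True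
      then show ?thesis using e_notin e by (simp add: Diff_insert_absorb)
    next
      case False
      then have x': "x \<in> T'" "x \<noteq> f" using x by auto
      have "insert e (T' - {f}) - {x} = insert e (T' - {f} - {x})" using False by auto
      moreover have "\<not> spans X (T' - {f} - {x}) x"
        using T' x' spans_mono[of X "T' - {f} - {x}" x "T' - {x}"] by auto
      moreover have "insert x (T' - {f} - {x}) = T' - {f}" using x' by auto
      ultimately show ?thesis using e_notin spans_exchange by metis
    qed
  qed (use T' eE in auto)
  ultimately show ?thesis unfolding swap_def using e fT ins by blast
qed

lemma swap_edges: "spanning_tree X T \<Longrightarrow> swap X T e f \<Longrightarrow> e \<in> edges X \<and> f \<in> edges X \<and> e \<noteq> f"
  unfolding swap_def spanning_tree_def by blast

lemma sum_swap:
  fixes c :: "'e \<Rightarrow> real"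
  assumes "spanning_tree X T" "swap X T e f"
  shows "sum c (insert f (T - {e})) = sum c T - c e + c f"
proof -
  have "finite T" using assms spanning_tree_finite by blast
  then show ?thesis using assms(2) by (simp add: swap_def sum_diff1)
qed

text \<open>Local optimality is global: a symmetric exchange moves \<open>T'\<close> towards
  \<open>T\<close>, and as the same pair is also a swap of \<open>T\<close>, the move does not
  increase the weight of \<open>T'\<close>.\<close>

lemma is_mst_iff_swap:
  "is_mst X c T \<longleftrightarrow> spanning_tree X T \<and> (\<forall>e f. swap X T e f \<longrightarrow> c e \<le> c f)"
proof
  assume T: "is_mst X c T"
  have "c e \<le> c f" if s: "swap X T e f" for e f
  proof -
    have "sum c T \<le> sum c (insert f (T - {e}))" using T s by (simp add: is_mst_def swap_def)
    also have "\<dots> = sum c T - c e + c f" using T s by (intro sum_swap) (simp_all add: is_mst_def)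
    finally show ?thesis by simp
  qed
  then show "spanning_tree X T \<and> (\<forall>e f. swap X T e f \<longrightarrow> c e \<le> c f)"
    using T by (auto simp: is_mst_def)
next
  assume T: "spanning_tree X T \<and> (\<forall>e f. swap X T e f \<longrightarrow> c e \<le> c f)"
  then have finT: "finite T" using spanning_tree_finite by blast
  have "sum c T \<le> sum c T'" if "spanning_tree X T'" for T'
    using that
  proof (induction "card (T - T')" arbitrary: T' rule: less_induct)
    case less
    note finT' = spanning_tree_finite[OF less.prems]
    show ?case
    proof (cases "T \<subseteq> T'")
      case True
      have "T' \<subseteq> T"
      proof (rule ccontr)
        assume "\<not> T' \<subseteq> T"
        then obtain e where "e \<in> T'" "e \<notin> T" by blast
        then show False using symmetric_exchange[OF less.prems, of T e] T True
          unfolding swap_def by blast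
      qed
      then show ?thesis using True by simp
    next
      case False
      then obtain e where e: "e \<in> T" "e \<notin> T'" by blast
      then obtain f where f: "swap X T e f" "swap X T' f e"
        using symmetric_exchange T less.prems by blast
      let ?T = "insert e (T' - {f})"
      have "T - ?T \<subset> T - T'" using e f by (auto simp: swap_def)
      then have "card (T - ?T) < card (T - T')" using finT by (simp add: psubset_card_mono)
      then have "sum c T \<le> sum c ?T" using less.hyps[of ?T] f(2) by (simp add: swap_def)
      also have "\<dots> = sum c T' - c f + c e" by (rule sum_swap[OF less.prems f(2)])
      also have "\<dots> \<le> sum c T'" using T f(1) by simp
      finally show ?thesis .
    qed
  qed
  then show "is_mst X c T" using T by (simp add: is_mst_def)
qed

end

section \<open>Known weights and certified trees\<close>

definition lo :: "('v, 'e) mst_input \<Rightarrow> ('e \<rightharpoonup> real) \<Rightarrow> 'e \<Rightarrow> real" where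
  "lo X r e = (case r e of Some y \<Rightarrow> y | None \<Rightarrow> lower X e)"

definition hi :: "('v, 'e) mst_input \<Rightarrow> ('e \<rightharpoonup> real) \<Rightarrow> 'e \<Rightarrow> real" where
  "hi X r e = (case r e of Some y \<Rightarrow> y | None \<Rightarrow> upper X e)"

definition in_intervals :: "('v, 'e) mst_input \<Rightarrow> ('e \<Rightarrow> real) \<Rightarrow> bool" where
  "in_intervals X w \<longleftrightarrow> (\<forall>e\<in>edges X. w e \<in> interval X e)"

definition certified :: "('v, 'e) mst_input \<Rightarrow> ('e \<rightharpoonup> real) \<Rightarrow> 'e set \<Rightarrow> bool" where
  "certified X r T \<longleftrightarrow> spanning_tree X T \<and> (\<forall>a b. swap X T a b \<longrightarrow> hi X r a \<le> lo X r b)"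

lemma dom_revealed [simp]: "dom (revealed w Q) = Q"
  by (auto simp: revealed_def split: if_splits)

lemma lo_hi_unknown: "e \<notin> dom r \<Longrightarrow> lo X r e = lower X e" "e \<notin> dom r \<Longrightarrow> hi X r e = upper X e"
  by (auto simp: lo_def hi_def split: option.splits)

lemma lo_hi_known: "r e = Some y \<Longrightarrow> lo X r e = y" "r e = Some y \<Longrightarrow> hi X r e = y"
  by (auto simp: lo_def hi_def)

lemma finite_obtain_min:
  fixes g :: "'b \<Rightarrow> real"
  assumes "finite S" "x \<in> S"
  obtains y where "y \<in> S" "\<And>z. z \<in> S \<Longrightarrow> g y \<le> g z"
  using assms ex_is_arg_min_if_finite[of S g]
  by (metis empty_iff is_arg_min_linorder)

lemma finite_obtain_max:
  fixes g :: "'b \<Rightarrow> real"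
  assumes "finite S" "x \<in> S"
  obtains y where "y \<in> S" "\<And>z. z \<in> S \<Longrightarrow> g z \<le> g y"
  using finite_obtain_min[OF assms, of "\<lambda>z. - g z"] by auto

text \<open>The bounds \<open>l'\<close>, \<open>h'\<close> arise from \<open>l\<close>, \<open>h\<close> by learning the weights of some edges. Since
  non-trivial intervals are open, a newly learnt weight lies strictly inside.\<close>

definition refines :: "'e set \<Rightarrow> ('e \<Rightarrow> real) \<Rightarrow> ('e \<Rightarrow> real) \<Rightarrow> ('e \<Rightarrow> real) \<Rightarrow> ('e \<Rightarrow> real) \<Rightarrow> bool" where
  "refines E l h l' h' \<longleftrightarrow> (\<forall>x\<in>E. l x \<le> h x \<and>
     (l' x = l x \<and> h' x = h x \<or> l x < l' x \<and> l' x = h' x \<and> h' x < h x))"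

text \<open>\<open>lower_tree\<close> and \<open>upper_tree\<close> are the swap criteria for limit trees: ties are broken
  by the infinitesimal perturbation of the edges whose weight is not yet determined.\<close>

definition lower_tree ::
  "('v, 'e) mst_input \<Rightarrow> ('e \<Rightarrow> real) \<Rightarrow> ('e \<Rightarrow> real) \<Rightarrow> 'e set \<Rightarrow> bool" where
  "lower_tree X l h T \<longleftrightarrow> spanning_tree X T \<and>
     (\<forall>a b. swap X T a b \<longrightarrow> l a < l b \<or> l a = l b \<and> (l a = h a \<or> l b < h b))"

definition upper_tree ::
  "('v, 'e) mst_input \<Rightarrow> ('e \<Rightarrow> real) \<Rightarrow> ('e \<Rightarrow> real) \<Rightarrow> 'e set \<Rightarrow> bool" where
  "upper_tree X l h T \<longleftrightarrow> spanning_tree X T \<and>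
     (\<forall>a b. swap X T a b \<longrightarrow> h a < h b \<or> h a = h b \<and> (l a < h a \<or> l b = h b))"

context uncertain_mst
begin

lemma lower_le_upper: "e \<in> edges X \<Longrightarrow> lower X e \<le> upper X e"
  using valid by (simp add: valid_input_def)

lemma in_intervals_predicted: "in_intervals X (predicted X)"
  using valid by (simp add: valid_input_def in_intervals_def)

lemma lo_le_hi: "e \<in> edges X \<Longrightarrow> lo X r e \<le> hi X r e"
  by (simp add: lo_def hi_def lower_le_upper split: option.split)

lemma refines_revealed:
  assumes w: "in_intervals X w" and r: "\<And>e. e \<in> dom r \<Longrightarrow> r e = Some (w e)" and Q: "dom r \<subseteq> Q"
  shows "refines (edges X) (lo X r) (hi X r) (lo X (revealed w Q)) (hi X (revealed w Q))"
  unfolding refines_def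
proof
  fix x assume x: "x \<in> edges X"
  have iv: "w x \<in> interval X x" using w x by (simp add: in_intervals_def)
  show "lo X r x \<le> hi X r x \<and> (lo X (revealed w Q) x = lo X r x \<and> hi X (revealed w Q) x = hi X r x \<or>
    lo X r x < lo X (revealed w Q) x \<and> lo X (revealed w Q) x = hi X (revealed w Q) x \<and>
    hi X (revealed w Q) x < hi X r x)"
  proof (cases "r x")
    case None
    then show ?thesis using x iv lower_le_upper[OF x]
      by (auto simp: lo_def hi_def revealed_def interval_def trivial_def split: if_splits)
  next
    case (Some y)
    then have "x \<in> dom r" by auto
    then have "x \<in> Q" "y = w x" using r Q Some by auto
    then show ?thesis using Some by (simp add: lo_def hi_def revealed_def)
  qed
qed

lemma revealed_between:
  assumes "in_intervals X w" "x \<in> edges X"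
  shows "lo X (revealed w Q) x \<le> w x" "w x \<le> hi X (revealed w Q) x"
proof -
  have "w x \<in> interval X x" using assms by (simp add: in_intervals_def)
  then show "lo X (revealed w Q) x \<le> w x" "w x \<le> hi X (revealed w Q) x"
    by (auto simp: lo_def hi_def revealed_def interval_def trivial_def split: if_splits)
qed

lemma weight_above:
  assumes "in_intervals X w" "x \<in> edges X" "m < hi X (revealed w Q) x"
  shows "\<exists>y > m. y \<in> interval X x \<and> (x \<in> Q \<longrightarrow> y = w x)"
proof (cases "x \<in> Q \<or> trivial X x")
  case True
  then have "w x = hi X (revealed w Q) x"
    using assms by (auto simp: hi_def revealed_def in_intervals_def interval_def trivial_def)
  moreover have "w x \<in> interval X x" using assms by (simp add: in_intervals_def)
  ultimately show ?thesis using assms(3) by metis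
next
  case False
  then have "lower X x < upper X x" "m < upper X x" using assms lower_le_upper[of x]
    by (auto simp: hi_def revealed_def trivial_def less_le)
  \<comment> \<open>The maximum with \<open>lower X x\<close> keeps the midpoint inside the interval
    even if \<open>m\<close> lies below it.\<close>
  then show ?thesis using False
    by (intro exI[of _ "(max m (lower X x) + upper X x) / 2"]) (auto simp: interval_def)
qed

lemma weight_below:
  assumes "in_intervals X w" "x \<in> edges X" "lo X (revealed w Q) x < m"
  shows "\<exists>y < m. y \<in> interval X x \<and> (x \<in> Q \<longrightarrow> y = w x)"
proof (cases "x \<in> Q \<or> trivial X x")
  case True
  then have "w x = lo X (revealed w Q) x"
    using assms by (auto simp: lo_def revealed_def in_intervals_def interval_def trivial_def)
  moreover have "w x \<in> interval X x" using assms by (simp add: in_intervals_def)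
  ultimately show ?thesis using assms(3) by metis
next
  case False
  then have "lower X x < upper X x" "lower X x < m" using assms lower_le_upper[of x]
    by (auto simp: lo_def revealed_def trivial_def less_le)
  then show ?thesis using False
    by (intro exI[of _ "(min m (upper X x) + lower X x) / 2"]) (auto simp: interval_def)
qed

text \<open>The weights of distinct edges vary independently. If \<open>hi\<close> of
  \<open>a\<close> exceeds \<open>lo\<close> of \<open>b\<close>, a number strictly between them can
  be passed from above by \<open>a\<close> and from below by \<open>b\<close> at the same time, so
  the tree fails for that assignment.\<close>

lemma feasible_iff:
  assumes w: "in_intervals X w"
  shows "feasible X w Q \<longleftrightarrow> Q \<subseteq> edges X \<and> (\<exists>T. certified X (revealed w Q) T)"
proof -
  let ?ok = "\<lambda>w'. (\<forall>e\<in>Q. w' e = w e) \<and> (\<forall>e\<in>edges X - Q. w' e \<in> interval X e)"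
  have "(\<forall>w'. ?ok w' \<longrightarrow> is_mst X w' T) \<longleftrightarrow>
      (\<forall>a b. swap X T a b \<longrightarrow> hi X (revealed w Q) a \<le> lo X (revealed w Q) b)"
    if Q: "Q \<subseteq> edges X" and T: "spanning_tree X T" for T
  proof
    assume mst: "\<forall>w'. ?ok w' \<longrightarrow> is_mst X w' T"
    show "\<forall>a b. swap X T a b \<longrightarrow> hi X (revealed w Q) a \<le> lo X (revealed w Q) b"
    proof (intro allI impI, rule ccontr)
      fix a b assume s: "swap X T a b" and "\<not> hi X (revealed w Q) a \<le> lo X (revealed w Q) b"
      then obtain m where m: "lo X (revealed w Q) b < m" "m < hi X (revealed w Q) a"
        using dense not_le by metis
      have ab: "a \<in> edges X" "b \<in> edges X" "a \<noteq> b" using swap_edges[OF T s] by auto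
      obtain y where y: "y > m" "y \<in> interval X a" "a \<in> Q \<longrightarrow> y = w a"
        using weight_above[OF w ab(1) m(2)] by blast
      obtain z where z: "z < m" "z \<in> interval X b" "b \<in> Q \<longrightarrow> z = w b"
        using weight_below[OF w ab(2) m(1)] by blast
      have "?ok (w(a := y, b := z))" using y z w by (auto simp: in_intervals_def)
      then have "is_mst X (w(a := y, b := z)) T" using mst by blast
      then have "(w(a := y, b := z)) a \<le> (w(a := y, b := z)) b" using s is_mst_iff_swap by blast
      then show False using ab y z by simp
    qed
  next
    assume cert: "\<forall>a b. swap X T a b \<longrightarrow> hi X (revealed w Q) a \<le> lo X (revealed w Q) b"
    show "\<forall>w'. ?ok w' \<longrightarrow> is_mst X w' T"
    proof (intro allI impI)
      fix w' assume ok: "?ok w'"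
      then have w': "in_intervals X w'" "revealed w Q = revealed w' Q"
        using w by (auto simp: in_intervals_def revealed_def)
      have "w' a \<le> w' b" if s: "swap X T a b" for a b
        using cert[rule_format, OF s] swap_edges[OF T s] revealed_between[OF w'(1), of _ Q]
        unfolding w'(2) by (meson order_trans)
      then show "is_mst X w' T" using T is_mst_iff_swap by blast
    qed
  qed
  then show ?thesis unfolding feasible_def certified_def by blast
qed

lemma certified_refines:
  assumes "certified X r T" "refines (edges X) (lo X r) (hi X r) (lo X r') (hi X r')"
  shows "certified X r' T"
proof -
  have "hi X r' a \<le> lo X r' b" if "swap X T a b" for a b
  proof -
    have "a \<in> edges X" "b \<in> edges X" using swap_edges that assms(1) by (auto simp: certified_def)
    then have "hi X r' a \<le> hi X r a" "lo X r b \<le> lo X r' b"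
      using assms(2) by (auto simp: refines_def)
    then show ?thesis using assms(1) that by (fastforce simp: certified_def)
  qed
  then show ?thesis using assms(1) by (simp add: certified_def)
qed

lemma feasible_mono:
  assumes w: "in_intervals X w" and Q: "feasible X w Q" "Q \<subseteq> Q'" "Q' \<subseteq> edges X"
  shows "feasible X w Q'"
proof -
  have "refines (edges X) (lo X (revealed w Q)) (hi X (revealed w Q))
      (lo X (revealed w Q')) (hi X (revealed w Q'))"
    by (rule refines_revealed[OF w]) (use Q in \<open>auto simp: revealed_def split: if_splits\<close>)
  then show ?thesis using Q certified_refines unfolding feasible_iff[OF w] by blast
qed

text \<open>The cycle that \<open>f\<close> closes with \<open>T'\<close> crosses the cut of
  \<open>T - {e}\<close> in \<open>f\<close>, hence in a second edge \<open>x\<close>. The exchange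
  is taken between \<open>T'\<close> and the tree obtained by swapping \<open>e\<close> for
  \<open>f\<close>.\<close>

lemma swap_exchange_in:
  assumes T: "spanning_tree X T" and T': "spanning_tree X T'" and s: "swap X T e f" and f: "f \<notin> T'"
  obtains x where "swap X T' x f" "x = e \<or> swap X T e x"
proof -
  let ?T = "insert f (T - {e})"
  have "spanning_tree X ?T" "f \<in> ?T" using s by (auto simp: swap_def)
  from symmetric_exchange[OF this(1) T' this(2) f] obtain x where
    x: "swap X ?T f x" "swap X T' x f" by blast
  have "insert x (?T - {f}) = insert x (T - {e})" using s by (auto simp: swap_def)
  moreover have "spanning_tree X (insert x (?T - {f}))" "e \<in> T" "x = e \<or> x \<notin> T"
    using x(1) s unfolding swap_def by blast+
  ultimately have "x = e \<or> swap X T e x" unfolding swap_def by simp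
  then show ?thesis using x that by blast
qed

text \<open>Dually, the cycle that \<open>f\<close> closes with \<open>T\<close> crosses the cut of
  \<open>T' - {e}\<close> in \<open>e\<close>, hence in a second edge \<open>x\<close>.\<close>

lemma swap_exchange_out:
  assumes T: "spanning_tree X T" and T': "spanning_tree X T'" and s: "swap X T e f" and e: "e \<in> T'"
  obtains x where "swap X T' e x" "x = f \<or> swap X T x f"
proof -
  let ?T = "insert f (T - {e})"
  have t: "spanning_tree X ?T" "e \<notin> ?T" using s by (auto simp: swap_def)
  from symmetric_exchange[OF T' t(1) e t(2)] obtain x where
    x: "swap X T' e x" "swap X ?T x e" by blast
  have "insert e (?T - {x}) = insert f (T - {x})" if "x \<noteq> f" "x \<noteq> e"
    using s that by (auto simp: swap_def)
  moreover have "x \<noteq> e" using x(2) by (auto simp: swap_def)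
  moreover have "x \<in> insert f (T - {e})" "spanning_tree X (insert e (?T - {x}))" "f \<notin> T"
    using x(2) s by (simp_all add: swap_def)
  ultimately have "x = f \<or> swap X T x f" unfolding swap_def by (metis Diff_iff insertE)
  then show ?thesis using x that by blast
qed

text \<open>If \<open>T'\<close> drops \<open>e\<close>, some \<open>x\<close> across the cut of
  \<open>e\<close> gets \<open>h' x \<le> l e\<close>, while the lower tree gives
  \<open>l e \<le> l x\<close>. An open interval leaves room for this only if \<open>x\<close> was
  determined before; then the tie rule forces \<open>l e = h e\<close>, against
  \<open>l e \<le> l f < h e\<close>. If \<open>T'\<close> keeps \<open>e\<close>, then
  \<open>h e \<le> l' x\<close> for an \<open>x\<close> that is \<open>f\<close> or lies on the tree
  cycle of \<open>f\<close>. The overlap excludes \<open>f\<close>; for any other \<open>x\<close>,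
  \<open>l x \<le> l f < h e\<close> and \<open>h x \<le> h e\<close>, so neither its old lower
  limit nor a newly revealed weight reaches \<open>h e\<close>.\<close>

lemma lower_tree_witness:
  assumes T: "lower_tree X l h T" and s: "swap X T e f" and gt: "h e > l f"
    and max: "\<And>a. swap X T a f \<Longrightarrow> h a \<le> h e"
    and ref: "refines (edges X) l h l' h'"
    and T': "spanning_tree X T'" "\<And>a b. swap X T' a b \<Longrightarrow> h' a \<le> l' b"
    and e: "l' e = l e" "h' e = h e" and f: "l' f = l f"
  shows False
proof -
  have tree: "spanning_tree X T" using T by (simp add: lower_tree_def)
  note low = T[unfolded lower_tree_def, THEN conjunct2, rule_format]
  note E = swap_edges[OF tree]
  note rf = ref[unfolded refines_def, rule_format]
  show False
  proof (cases "e \<in> T'")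
    case False
    then obtain x where x: "swap X T e x" "swap X T' x e"
      using symmetric_exchange[OF tree T'(1)] s by (auto simp: swap_def)
    have "h' x \<le> l e" using T'(2)[OF x(2)] e by simp
    moreover have "x \<in> edges X" "e \<in> edges X" "f \<in> edges X" using E x(1) s by auto
    ultimately show False using low[OF x(1)] low[OF s] rf[of x] rf[of e] rf[of f] gt by auto
  next
    case True
    then obtain x where x: "swap X T' e x" "x = f \<or> swap X T x f"
      using swap_exchange_out[OF tree T'(1) s] by blast
    have ge: "h e \<le> l' x" using T'(2)[OF x(1)] e by simp
    then have "x \<noteq> f" using gt f by auto
    then have xf: "swap X T x f" using x by blast
    then have "x \<in> edges X" using E by auto
    then show False using ge gt low[OF xf] max[OF xf] rf[of x] by auto
  qed
qed

text \<open>Dual to \<open>lower_tree_witness\<close>, with the cut of \<open>e\<close> in place of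
  the cycle of \<open>f\<close>. If \<open>T'\<close> contains \<open>f\<close>, the tie rule forces
  \<open>l f = h f\<close>, against \<open>l f < h e \<le> h f\<close>. Otherwise
  \<open>h' x \<le> l f\<close> for \<open>x = e\<close>, which the overlap excludes, or for another
  \<open>x\<close> of the cut; minimality of \<open>l f\<close> then forces
  \<open>h x = l f < h e\<close>, against the upper tree.\<close>

lemma upper_tree_witness:
  assumes T: "upper_tree X l h T" and s: "swap X T e f" and gt: "h e > l f"
    and min: "\<And>b. swap X T e b \<Longrightarrow> l f \<le> l b"
    and ref: "refines (edges X) l h l' h'"
    and T': "spanning_tree X T'" "\<And>a b. swap X T' a b \<Longrightarrow> h' a \<le> l' b"
    and f: "l' f = l f" "h' f = h f" and e: "h' e = h e"
  shows False
proof -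
  have tree: "spanning_tree X T" using T by (simp add: upper_tree_def)
  note upp = T[unfolded upper_tree_def, THEN conjunct2, rule_format]
  note E = swap_edges[OF tree]
  note rf = ref[unfolded refines_def, rule_format]
  show False
  proof (cases "f \<in> T'")
    case True
    then obtain x where x: "swap X T' f x" "swap X T x f"
      using symmetric_exchange[OF T'(1) tree] s by (auto simp: swap_def)
    have "h f \<le> l' x" using T'(2)[OF x(1)] f by simp
    moreover have "x \<in> edges X" "e \<in> edges X" "f \<in> edges X" using E x(2) s by auto
    ultimately show False using upp[OF x(2)] upp[OF s] rf[of x] rf[of e] rf[of f] gt by auto
  next
    case False
    then obtain x where x: "swap X T' x f" "x = e \<or> swap X T e x"
      using swap_exchange_in[OF tree T'(1) s] by blast
    have le: "h' x \<le> l f" using T'(2)[OF x(1)] f by simp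
    then have "x \<noteq> e" using gt e by auto
    then have ex: "swap X T e x" using x by blast
    then have "x \<in> edges X" using E by auto
    then show False using le gt upp[OF ex] min[OF ex] rf[of x] by auto
  qed
qed

end

section \<open>Witness sets\<close>

text \<open>\<open>Q\<close> ranges over all feasible sets, not only those extending
  \<open>dom r\<close>. So a set found during the run bounds the true optimum, and stays a witness
  set as more weights become known.\<close>

definition witness :: "('v, 'e) mst_input \<Rightarrow> ('e \<rightharpoonup> real) \<Rightarrow> 'e set \<Rightarrow> bool" where
  "witness X r W \<longleftrightarrow> (\<forall>w Q. in_intervals X w \<and> (\<forall>e\<in>dom r. r e = Some (w e)) \<and> feasible X w Q
     \<longrightarrow> Q \<inter> W \<noteq> {})"

lemma witness_mono: "witness X r W \<Longrightarrow> r \<subseteq>\<^sub>m r' \<Longrightarrow> witness X r' W"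
  unfolding witness_def map_le_def by (metis domIff option.distinct(1))

lemma card_witnesses_le:
  assumes fin: "finite Q" and disj: "pairwise disjnt \<W>" and hit: "\<And>W. W \<in> \<W> \<Longrightarrow> Q \<inter> W \<noteq> {}"
  shows "finite \<W> \<and> card \<W> \<le> card Q"
proof -
  define g where "g W = (SOME x. x \<in> Q \<inter> W)" for W
  have g: "g W \<in> Q \<inter> W" if "W \<in> \<W>" for W
    using hit[OF that] unfolding g_def by (metis ex_in_conv someI_ex)
  have "inj_on g \<W>"
  proof (rule inj_onI, rule ccontr)
    fix U W assume "U \<in> \<W>" "W \<in> \<W>" "g U = g W" "U \<noteq> W"
    then show False using g[of U] g[of W] disj unfolding pairwise_def disjnt_def by auto
  qed
  moreover have "g ` \<W> \<subseteq> Q" using g by blast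
  ultimately show ?thesis using fin by (metis card_inj_on_le finite_imageD finite_subset)
qed

context uncertain_mst
begin

text \<open>A feasible set may be enlarged by \<open>dom r\<close>, which does not meet
  \<open>W\<close>; after that, the knowledge it provides refines \<open>r\<close>.\<close>

lemma witnessI:
  assumes "dom r \<subseteq> edges X" "W \<inter> dom r = {}"
    and contr: "\<And>w Q T. in_intervals X w \<Longrightarrow> Q \<inter> W = {} \<Longrightarrow>
      refines (edges X) (lo X r) (hi X r) (lo X (revealed w Q)) (hi X (revealed w Q)) \<Longrightarrow>
      certified X (revealed w Q) T \<Longrightarrow> (\<And>e. e \<in> dom r \<Longrightarrow> r e = Some (w e)) \<Longrightarrow> dom r \<subseteq> Q \<Longrightarrow> False"
  shows "witness X r W"
  unfolding witness_def
proof (intro allI impI notI)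
  fix w Q
  assume *: "in_intervals X w \<and> (\<forall>e\<in>dom r. r e = Some (w e)) \<and> feasible X w Q" and QW: "Q \<inter> W = {}"
  then have w: "in_intervals X w" and r: "\<And>e. e \<in> dom r \<Longrightarrow> r e = Some (w e)"
    and Q: "feasible X w Q" by blast+
  have "Q \<subseteq> edges X" using Q by (simp add: feasible_def)
  then have "feasible X w (Q \<union> dom r)" using feasible_mono[OF w Q] assms(1) by blast
  then obtain T where "certified X (revealed w (Q \<union> dom r)) T" using feasible_iff[OF w] by blast
  moreover have "refines (edges X) (lo X r) (hi X r) (lo X (revealed w (Q \<union> dom r)))
      (hi X (revealed w (Q \<union> dom r)))"
    by (rule refines_revealed[OF w r]) auto
  ultimately show False using contr[of w "Q \<union> dom r" T] w r QW assms(2) by blast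
qed

lemma unqueried_eq:
  assumes "refines (edges X) (lo X r) (hi X r) (lo X (revealed w Q)) (hi X (revealed w Q))"
    and "Q \<inter> {y \<in> S. lo X r y < hi X r y} = {}" "dom r \<subseteq> Q" "x \<in> S" "x \<in> edges X"
  shows "lo X (revealed w Q) x = lo X r x" "hi X (revealed w Q) x = hi X r x"
proof -
  have "lo X (revealed w Q) x = lo X r x \<and> hi X (revealed w Q) x = hi X r x"
  proof (cases "lo X r x < hi X r x")
    case True
    then have "x \<notin> Q" using assms by blast
    then have "x \<notin> dom r" using assms(3) by blast
    then show ?thesis using \<open>x \<notin> Q\<close> by (simp add: lo_hi_unknown)
  next
    case False
    then show ?thesis using assms(1,5) unfolding refines_def by fastforce
  qed
  then show "lo X (revealed w Q) x = lo X r x" "hi X (revealed w Q) x = hi X r x" by auto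
qed

lemma undetermined_unknown: "lo X r x < hi X r x \<Longrightarrow> x \<notin> dom r"
  by (auto simp: lo_hi_known)

section \<open>Witness pairs from lower and upper trees\<close>

lemma lower_tree_witness_pair:
  assumes r: "dom r \<subseteq> edges X" and T: "lower_tree X (lo X r) (hi X r) T" and s: "swap X T e f"
    and gt: "hi X r e > lo X r f" and max: "\<And>a. swap X T a f \<Longrightarrow> hi X r a \<le> hi X r e"
  shows "witness X r {x \<in> {e, f}. lo X r x < hi X r x}"
proof (rule witnessI[OF r])
  show "{x \<in> {e, f}. lo X r x < hi X r x} \<inter> dom r = {}" using undetermined_unknown by blast
next
  fix w Q T'
  assume *: "Q \<inter> {x \<in> {e, f}. lo X r x < hi X r x} = {}" "dom r \<subseteq> Q"
    "refines (edges X) (lo X r) (hi X r) (lo X (revealed w Q)) (hi X (revealed w Q))"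
    "certified X (revealed w Q) T'"
  have "spanning_tree X T" using T by (simp add: lower_tree_def)
  then have E: "e \<in> edges X" "f \<in> edges X" using swap_edges s by auto
  show False
    by (rule lower_tree_witness[OF T s gt max *(3)])
      (use *(4) unqueried_eq[OF *(3,1,2)] E in \<open>auto simp: certified_def\<close>)
qed

lemma upper_tree_witness_pair:
  assumes r: "dom r \<subseteq> edges X" and T: "upper_tree X (lo X r) (hi X r) T" and s: "swap X T e f"
    and gt: "hi X r e > lo X r f" and min: "\<And>b. swap X T e b \<Longrightarrow> lo X r f \<le> lo X r b"
  shows "witness X r {x \<in> {e, f}. lo X r x < hi X r x}"
proof (rule witnessI[OF r])
  show "{x \<in> {e, f}. lo X r x < hi X r x} \<inter> dom r = {}" using undetermined_unknown by blast
next
  fix w Q T'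
  assume *: "Q \<inter> {x \<in> {e, f}. lo X r x < hi X r x} = {}" "dom r \<subseteq> Q"
    "refines (edges X) (lo X r) (hi X r) (lo X (revealed w Q)) (hi X (revealed w Q))"
    "certified X (revealed w Q) T'"
  have "spanning_tree X T" using T by (simp add: upper_tree_def)
  then have E: "e \<in> edges X" "f \<in> edges X" using swap_edges s by auto
  show False
    by (rule upper_tree_witness[OF T s gt min *(3)])
      (use *(4) unqueried_eq[OF *(3,1,2)] E in \<open>auto simp: certified_def\<close>)
qed

text \<open>Lexicographic minimisation replaces the infinitesimal perturbation: first the total lower
  limit, then the number of undetermined edges.\<close>

lemma lower_tree_exists: "\<exists>T. lower_tree X (lo X r) (hi X r) T"
proof -
  let ?c = "\<lambda>x. if lo X r x < hi X r x then 1 else 0 :: real"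
  obtain T0 where "T0 \<in> {T. spanning_tree X T}" using spanning_tree_exists by blast
  then obtain T1 where T1: "spanning_tree X T1"
    "\<And>T'. spanning_tree X T' \<Longrightarrow> sum (lo X r) T1 \<le> sum (lo X r) T'"
    using finite_obtain_min[OF finite_spanning_trees, of T0 "sum (lo X r)"]
    by (metis mem_Collect_eq)
  let ?M = "{T. spanning_tree X T \<and> sum (lo X r) T = sum (lo X r) T1}"
  have "finite ?M" by (rule finite_subset[OF _ finite_spanning_trees]) auto
  then obtain T where T: "T \<in> ?M" "\<And>T'. T' \<in> ?M \<Longrightarrow> sum ?c T \<le> sum ?c T'"
    using finite_obtain_min[of ?M T1 "sum ?c"] T1(1) by blast
  have tree: "spanning_tree X T" using T(1) by blast
  have "lo X r a < lo X r b \<or> lo X r a = lo X r b \<and> (lo X r a = hi X r a \<or> lo X r b < hi X r b)"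
    if s: "swap X T a b" for a b
  proof -
    let ?T = "insert b (T - {a})"
    have st: "spanning_tree X ?T" using s by (simp add: swap_def)
    have "sum (lo X r) T \<le> sum (lo X r) ?T" using T(1) T1(2)[OF st] by simp
    then have le: "lo X r a \<le> lo X r b" using sum_swap[OF tree s, of "lo X r"] by simp
    have "lo X r a = hi X r a \<or> lo X r b < hi X r b" if eq: "lo X r a = lo X r b"
    proof -
      have "?T \<in> ?M" using st sum_swap[OF tree s, of "lo X r"] eq T(1) by simp
      then have "?c a \<le> ?c b" using T(2)[of ?T] sum_swap[OF tree s, of ?c] by linarith
      moreover have "lo X r a \<le> hi X r a" using lo_le_hi swap_edges[OF tree s] by blast
      ultimately show ?thesis by (auto split: if_splits)
    qed
    then show ?thesis using le by auto
  qed
  then show ?thesis using tree by (auto simp: lower_tree_def)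
qed

lemma finite_swaps: "spanning_tree X T \<Longrightarrow> finite {a. swap X T a f}"
  using swap_edges finite_subset[OF _ finite_edges]
  by (metis (no_types, lifting) mem_Collect_eq subsetI)

text \<open>The lower tree is taken afresh for the current knowledge. Some swap violates its
  inequality, and \<open>e\<close> is chosen with largest \<open>hi\<close> on the cycle of
  \<open>f\<close>. Since \<open>lo\<close> of \<open>e\<close> is at most \<open>lo\<close> of
  \<open>f\<close> and thus below \<open>hi\<close> of \<open>e\<close>, the edge \<open>e\<close>
  is undetermined and the witness set is not empty; it has size one if \<open>f\<close> is
  determined.\<close>

lemma witness_exists:
  assumes r: "dom r \<subseteq> edges X" and n: "\<not> (\<exists>T. certified X r T)"
  obtains W where "W \<subseteq> edges X - dom r" "W \<noteq> {}" "finite W" "card W \<le> 2" "witness X r W"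
proof -
  obtain T where T: "lower_tree X (lo X r) (hi X r) T" using lower_tree_exists by blast
  then have tree: "spanning_tree X T" by (simp add: lower_tree_def)
  then obtain a f where af: "swap X T a f" "hi X r a > lo X r f"
    using n by (force simp: certified_def)
  obtain e where e: "swap X T e f" "\<And>a. swap X T a f \<Longrightarrow> hi X r a \<le> hi X r e"
    using finite_obtain_max[OF finite_swaps[OF tree], of a f "hi X r"] af(1) by auto
  have gt: "hi X r e > lo X r f" using af e by fastforce
  let ?W = "{x \<in> {e, f}. lo X r x < hi X r x}"
  have "lo X r e \<le> lo X r f" using T e(1) by (force simp: lower_tree_def)
  then have "e \<in> ?W" using gt by auto
  moreover have "?W \<subseteq> edges X - dom r"
    using undetermined_unknown swap_edges[OF tree e(1)] by auto
  moreover have "card ?W \<le> 2"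
    by (rule order_trans[OF card_mono[of "{e, f}"]]) (auto simp: card_insert_if)
  moreover have "witness X r ?W" by (rule lower_tree_witness_pair[OF r T e(1) gt e(2)])
  ultimately show ?thesis using that[of ?W] by auto
qed

end

section \<open>Hall's and Koenig's theorems\<close>

text \<open>The Halmos-Vaughan induction: a nonempty proper tight set is matched within its
  neighbourhood and the rest outside of it. Without a tight set every nonempty proper subset has a
  spare neighbour, so one element may take any neighbour \<open>x\<close> away.\<close>

lemma hall:
  assumes "finite I" "\<And>i. i \<in> I \<Longrightarrow> finite (N i)"
    and "\<And>S. S \<subseteq> I \<Longrightarrow> card S \<le> card (\<Union>i\<in>S. N i)"
  shows "\<exists>f. inj_on f I \<and> (\<forall>i\<in>I. f i \<in> N i)"
  using assms
proof (induction "card I" arbitrary: I N rule: less_induct)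
  case less
  note finI = less.prems(1) and finN = less.prems(2) and hall = less.prems(3)
  show ?case
  proof (cases "I = {}")
    case False
    show ?thesis
    proof (cases "\<exists>S. S \<subset> I \<and> S \<noteq> {} \<and> card S = card (\<Union>i\<in>S. N i)")
      case True
      then obtain S where S: "S \<subset> I" "S \<noteq> {}" "card S = card (\<Union>i\<in>S. N i)" by blast
      have finS: "finite S" using S finI by (meson finite_subset psubset_imp_subset)
      have cS: "card S < card I" by (rule psubset_card_mono[OF finI S(1)])
      have "I - S \<subset> I" using S by blast
      then have "card (I - S) < card I" by (rule psubset_card_mono[OF finI])
      let ?U = "\<Union>i\<in>S. N i"
      have finU: "finite ?U" using finS finN S by auto
      obtain f where f: "inj_on f S" "\<forall>i\<in>S. f i \<in> N i"
      proof -
        have "\<exists>f. inj_on f S \<and> (\<forall>i\<in>S. f i \<in> N i)"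
          by (rule less.hyps[OF cS finS finN hall]) (use S(1) in auto)
        then show ?thesis using that by blast
      qed
      have "card R \<le> card (\<Union>i\<in>R. N i - ?U)" if R: "R \<subseteq> I - S" for R
      proof -
        have finR: "finite R" using R finI by (meson finite_Diff finite_subset)
        have finUR: "finite (\<Union>i\<in>R. N i - ?U)" using finR R finN by auto
        have "card R + card S = card (R \<union> S)"
          using R finR finS by (subst card_Un_disjoint) auto
        also have "\<dots> \<le> card (\<Union>i\<in>R \<union> S. N i)" by (rule hall) (use R S in auto)
        also have "(\<Union>i\<in>R \<union> S. N i) = (\<Union>i\<in>R. N i - ?U) \<union> ?U" by auto
        also have "card \<dots> = card (\<Union>i\<in>R. N i - ?U) + card ?U"
          using finUR finU by (subst card_Un_disjoint) auto
        finally show ?thesis using S(3) by simp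
      qed
      then obtain g where g: "inj_on g (I - S)" "\<forall>i\<in>I - S. g i \<in> N i - ?U"
        using less.hyps[OF \<open>card (I - S) < card I\<close>, of "\<lambda>i. N i - ?U"] finI finN by auto
      let ?h = "\<lambda>i. if i \<in> S then f i else g i"
      have "inj_on ?h I"
      proof (rule inj_onI)
        fix i j assume ij: "i \<in> I" "j \<in> I" "?h i = ?h j"
        show "i = j"
        proof (cases "i \<in> S \<longleftrightarrow> j \<in> S")
          case True
          then consider "i \<in> S" "j \<in> S" | "i \<in> I - S" "j \<in> I - S" using ij by blast
          then show ?thesis
          proof cases
            case 1
            then show ?thesis using ij(3) f(1) by (simp add: inj_on_eq_iff)
          next
            case 2
            then show ?thesis using ij(3) g(1) by (simp add: inj_on_eq_iff)
          qed
        next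
          case False
          have f': "f k \<in> ?U" if "k \<in> S" for k using that f(2) by blast
          have g': "g k \<notin> ?U" if "k \<in> I" "k \<notin> S" for k using that g(2) by blast
          from False show ?thesis using ij f'[of i] f'[of j] g'[of i] g'[of j] by (metis (no_types))
        qed
      qed
      then show ?thesis using f(2) g(2) by (intro exI[of _ ?h]) auto
    next
      case no_tight: False
      obtain i where i: "i \<in> I" using False by blast
      have "card {i} \<le> card (\<Union>j\<in>{i}. N j)" by (rule hall) (use i in simp)
      then obtain x where x: "x \<in> N i" by fastforce
      have less_I: "card (I - {i}) < card I" using finI i by (meson card_Diff1_less)
      have "card R \<le> card (\<Union>j\<in>R. N j - {x})" if R: "R \<subseteq> I - {i}" for R
      proof (cases "R = {}")
        case False
        have finU: "finite (\<Union>j\<in>R. N j)" using R finI finN by (meson DiffE finite_Diff finite_UN_I finite_subset subsetD)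
        have "card R \<le> card (\<Union>j\<in>R. N j)" by (rule hall) (use R in auto)
        moreover have "R \<subset> I" using R i by auto
        then have "card R \<noteq> card (\<Union>j\<in>R. N j)" using no_tight False by blast
        ultimately have "card R < card (\<Union>j\<in>R. N j)" by linarith
        moreover have "(\<Union>j\<in>R. N j - {x}) = (\<Union>j\<in>R. N j) - {x}" by auto
        ultimately show ?thesis using finU by (auto simp: card_Diff_singleton_if)
      qed simp
      then obtain f where f: "inj_on f (I - {i})" "\<forall>j\<in>I - {i}. f j \<in> N j - {x}"
        using less.hyps[OF less_I, of "\<lambda>j. N j - {x}"] finI finN by auto
      have "inj_on (f(i := x)) I"
        using f by (auto simp: inj_on_def)
      moreover have "\<forall>j\<in>I. (f(i := x)) j \<in> N j" using f(2) x by auto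
      ultimately show ?thesis by blast
    qed
  qed simp
qed

text \<open>Finiteness is required because \<open>card\<close> of an infinite set is 0, which would
  spoil the comparison of sizes.\<close>

definition vertex_cover :: "('a \<times> 'b) set \<Rightarrow> 'a set \<Rightarrow> 'b set \<Rightarrow> bool" where
  "vertex_cover R A B \<longleftrightarrow> finite A \<and> finite B \<and> (\<forall>(a, b)\<in>R. a \<in> A \<or> b \<in> B)"

text \<open>Hall's condition follows from minimality: replacing a subset \<open>S\<close> of
  \<open>A\<close> by its neighbours outside \<open>B\<close> gives another cover, so these
  neighbours are at least as many as \<open>S\<close>.\<close>

lemma minimum_cover_matching:
  assumes R: "finite R" and cov: "vertex_cover R A B"
    and min: "\<And>A' B'. vertex_cover R A' B' \<Longrightarrow> card A + card B \<le> card A' + card B'"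
  shows "\<exists>f. inj_on f A \<and> (\<forall>a\<in>A. (a, f a) \<in> R \<and> f a \<notin> B)"
proof -
  let ?N = "\<lambda>a. {b. (a, b) \<in> R \<and> b \<notin> B}"
  have finN: "finite (?N a)" for a
    by (rule finite_subset[of _ "snd ` R"]) (use R in force)+
  have fin: "finite A" "finite B" using cov by (auto simp: vertex_cover_def)
  have "\<exists>f. inj_on f A \<and> (\<forall>a\<in>A. f a \<in> ?N a)"
  proof (rule hall[OF fin(1) finN])
    fix S assume S: "S \<subseteq> A"
    let ?U = "\<Union>a\<in>S. ?N a"
    have finU: "finite ?U" using S fin(1) finN by (meson finite_UN_I finite_subset)
    have finS: "finite S" using S fin(1) finite_subset by blast
    have "vertex_cover R (A - S) (B \<union> ?U)"
      using cov finU fin unfolding vertex_cover_def by auto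
    then have "card A + card B \<le> card (A - S) + card (B \<union> ?U)" by (rule min)
    moreover have "card (B \<union> ?U) = card B + card ?U"
      using fin finU by (intro card_Un_disjoint) auto
    moreover have "card (A - S) = card A - card S" "card S \<le> card A"
      using S finS fin(1) by (simp_all add: card_Diff_subset card_mono)
    ultimately show "card S \<le> card ?U" by linarith
  qed
  then show ?thesis by auto
qed

text \<open>The second matching comes from the converse relation. As \<open>f\<close> avoids
  \<open>B\<close> and \<open>g\<close> avoids \<open>A\<close>, both together form a single
  matching with one pair per covered vertex.\<close>

lemma koenig:
  assumes "finite R"
  obtains A B f g where "vertex_cover R A B"
    "inj_on f A" "\<And>a. a \<in> A \<Longrightarrow> (a, f a) \<in> R \<and> f a \<notin> B"
    "inj_on g B" "\<And>b. b \<in> B \<Longrightarrow> (g b, b) \<in> R \<and> g b \<notin> A"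
proof -
  have "vertex_cover R (fst ` R) {}" using assms by (force simp: vertex_cover_def)
  then obtain p where p: "vertex_cover R (fst p) (snd p)"
    "\<And>q. vertex_cover R (fst q) (snd q) \<Longrightarrow> card (fst p) + card (snd p) \<le> card (fst q) + card (snd q)"
    using ex_has_least_nat[of "\<lambda>p. vertex_cover R (fst p) (snd p)" "(fst ` R, {})"
        "\<lambda>p. card (fst p) + card (snd p)"] by auto
  let ?A = "fst p" and ?B = "snd p"
  have min: "card ?A + card ?B \<le> card A' + card B'" if "vertex_cover R A' B'" for A' B'
    using p(2)[of "(A', B')"] that by simp
  obtain f where f: "inj_on f ?A" "\<forall>a\<in>?A. (a, f a) \<in> R \<and> f a \<notin> ?B"
    using minimum_cover_matching[OF assms p(1) min] by blast
  have conv: "vertex_cover (R\<inverse>) B' A' \<longleftrightarrow> vertex_cover R A' B'" for A' B'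
    by (auto simp: vertex_cover_def)
  have "card ?B + card ?A \<le> card B' + card A'" if "vertex_cover (R\<inverse>) B' A'" for A' B'
    using min[of A' B'] that conv by simp
  from minimum_cover_matching[OF _ _ this] obtain g where
    g: "inj_on g ?B" "\<forall>b\<in>?B. (b, g b) \<in> R\<inverse> \<and> g b \<notin> ?A"
    using assms p(1) conv by (metis finite_converse)
  show ?thesis by (rule that[OF p(1) f(1) _ g(1)]) (use f(2) g(2) in auto)
qed

section \<open>Limit trees and predictions\<close>

lemma at_right_obtain:
  assumes "\<forall>\<^sub>F \<epsilon> in at_right (0::real). P \<epsilon>" "d > 0"
  obtains \<epsilon> where "0 < \<epsilon>" "\<epsilon> < d" "P \<epsilon>"
proof -
  have "\<forall>\<^sub>F \<epsilon> in at_right 0. \<epsilon> \<in> {0<..<d} \<and> P \<epsilon>"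
    using eventually_at_right_real[OF assms(2)] assms(1) by (rule eventually_conj)
  then obtain \<epsilon> where "\<epsilon> \<in> {0<..<d} \<and> P \<epsilon>"
    using eventually_happens trivial_limit_at_right_real by blast
  then show ?thesis using that[of \<epsilon>] by simp
qed

context uncertain_mst
begin

lemma lower_limit_tree_imp:
  assumes "lower_limit_tree X T"
  shows "lower_tree X (lower X) (upper X) T"
  unfolding lower_tree_def
proof (intro conjI allI impI)
  note lim = assms[unfolded lower_limit_tree_def]
  show "spanning_tree X T"
    using at_right_obtain[OF lim, of 1] is_mst_def by (metis zero_less_one)
  fix a b assume s: "swap X T a b"
  \<comment> \<open>A perturbation smaller than the gap cannot make up for a strictly larger limit
    of \<open>a\<close>; at equal limits any positive value decides the tie.\<close>
  define d where "d = (if lower X a > lower X b then lower X a - lower X b else 1)"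
  have "d > 0" by (simp add: d_def)
  then obtain \<epsilon> where e: "0 < \<epsilon>" "\<epsilon> < d"
    "is_mst X (\<lambda>e. if trivial X e then lower X e else lower X e + \<epsilon>) T"
    using at_right_obtain[OF lim] by metis
  then have "(if trivial X a then lower X a else lower X a + \<epsilon>)
      \<le> (if trivial X b then lower X b else lower X b + \<epsilon>)"
    using s is_mst_iff_swap by auto
  moreover have "a \<in> edges X" "b \<in> edges X" using e(3) s swap_edges is_mst_def by blast+
  ultimately show "lower X a < lower X b \<or>
      lower X a = lower X b \<and> (lower X a = upper X a \<or> lower X b < upper X b)"
    using e(1,2) lower_le_upper[of a] lower_le_upper[of b]
    by (auto simp: d_def trivial_def split: if_splits)
qed

lemma upper_limit_tree_imp:
  assumes "upper_limit_tree X T"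
  shows "upper_tree X (lower X) (upper X) T"
  unfolding upper_tree_def
proof (intro conjI allI impI)
  note lim = assms[unfolded upper_limit_tree_def]
  show "spanning_tree X T"
    using at_right_obtain[OF lim, of 1] is_mst_def by (metis zero_less_one)
  fix a b assume s: "swap X T a b"
  define d where "d = (if upper X a > upper X b then upper X a - upper X b else 1)"
  have "d > 0" by (simp add: d_def)
  then obtain \<epsilon> where e: "0 < \<epsilon>" "\<epsilon> < d"
    "is_mst X (\<lambda>e. if trivial X e then upper X e else upper X e - \<epsilon>) T"
    using at_right_obtain[OF lim] by metis
  then have "(if trivial X a then upper X a else upper X a - \<epsilon>)
      \<le> (if trivial X b then upper X b else upper X b - \<epsilon>)"
    using s is_mst_iff_swap by auto
  moreover have "a \<in> edges X" "b \<in> edges X" using e(3) s swap_edges is_mst_def by blast+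
  ultimately show "upper X a < upper X b \<or>
      upper X a = upper X b \<and> (lower X a < upper X a \<or> lower X b = upper X b)"
    using e(1,2) lower_le_upper[of a] lower_le_upper[of b]
    by (auto simp: d_def trivial_def split: if_splits)
qed

text \<open>Non-mandatory edges enter through one certificate that leaves \<open>e\<close>
  unqueried. Only its bounds and its tree are kept, so the exchange arguments need no query
  sets.\<close>

lemma not_mandatory:
  assumes "prediction_mandatory_free X" "e \<in> edges X"
  obtains l' h' T' where "refines (edges X) (lower X) (upper X) l' h'"
    "\<And>x. x \<in> edges X \<Longrightarrow> l' x \<le> predicted X x \<and> predicted X x \<le> h' x"
    "l' e = lower X e" "h' e = upper X e"
    "spanning_tree X T'" "\<And>a b. swap X T' a b \<Longrightarrow> h' a \<le> l' b"
proof -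
  obtain Q where Q: "feasible X (predicted X) Q" "e \<notin> Q"
    using assms by (auto simp: prediction_mandatory_free_def prediction_mandatory_def)
  let ?r = "revealed (predicted X) Q"
  obtain T' where T': "certified X ?r T'"
    using Q feasible_iff[OF in_intervals_predicted] by blast
  have emp: "lo X Map.empty = lower X" "hi X Map.empty = upper X"
    by (auto simp: lo_def hi_def)
  have "refines (edges X) (lower X) (upper X) (lo X ?r) (hi X ?r)"
    using refines_revealed[OF in_intervals_predicted, of Map.empty Q] by (simp add: emp)
  then show ?thesis
    using that[of "lo X ?r" "hi X ?r" T'] T' Q(2) revealed_between[OF in_intervals_predicted, of _ Q]
    by (simp add: certified_def lo_hi_unknown)
qed

context
  fixes T
  assumes free: "prediction_mandatory_free X"
    and low_tree: "lower_tree X (lower X) (upper X) T"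
    and upp_tree: "upper_tree X (lower X) (upper X) T"
begin

lemma tree: "spanning_tree X T"
  using low_tree by (simp add: lower_tree_def)

lemmas low = low_tree[unfolded lower_tree_def, THEN conjunct2, rule_format]
lemmas upp = upp_tree[unfolded upper_tree_def, THEN conjunct2, rule_format]
lemmas swap_in = swap_edges[OF tree]

lemma predicted_bounds:
  assumes "x \<in> edges X"
  shows "lower X x \<le> predicted X x" "predicted X x \<le> upper X x"
  using revealed_between[OF in_intervals_predicted assms, of "{}"] by (simp_all add: lo_hi_unknown)

text \<open>A non-tree edge that violates the bound and has minimum lower limit would be prediction
  mandatory; dually, in \<open>upper_le_predicted\<close>, a violating tree edge of maximum upper limit.\<close>

lemma predicted_le_lower:
  assumes "swap X T a b"
  shows "predicted X a \<le> lower X b"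
proof (rule ccontr)
  assume "\<not> predicted X a \<le> lower X b"
  let ?S = "{b \<in> edges X. \<exists>a. swap X T a b \<and> lower X b < predicted X a}"
  have "finite ?S" by simp
  moreover have "b \<in> ?S" using assms swap_in[OF assms] \<open>\<not> predicted X a \<le> lower X b\<close> by auto
  ultimately obtain c where c: "c \<in> ?S" "\<And>x. x \<in> ?S \<Longrightarrow> lower X c \<le> lower X x"
    by (rule finite_obtain_min[of ?S b "lower X"]) blast
  then obtain e where e: "swap X T e c" "lower X c < predicted X e" by blast
  have E: "e \<in> edges X" "c \<in> edges X" using swap_in[OF e(1)] by auto
  have "lower X c < upper X e" using e predicted_bounds[OF E(1)] by linarith
  moreover have "upper X e \<le> upper X c" using upp[OF e(1)] by linarith
  ultimately have nontriv: "lower X c < upper X c" by linarith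
  obtain l' h' T' where ref: "refines (edges X) (lower X) (upper X) l' h'"
    and pred: "\<And>x. x \<in> edges X \<Longrightarrow> l' x \<le> predicted X x \<and> predicted X x \<le> h' x"
    and lh: "l' c = lower X c" "h' c = upper X c"
    and T': "spanning_tree X T'" "\<And>a b. swap X T' a b \<Longrightarrow> h' a \<le> l' b"
    using not_mandatory[OF free E(2)] by metis
  note rf = ref[unfolded refines_def, rule_format]
  show False
  proof (cases "c \<in> T'")
    case True
    then obtain x where x: "swap X T' c x" "swap X T x c"
      using symmetric_exchange[OF T'(1) tree] e by (auto simp: swap_def)
    have xE: "x \<in> edges X" using swap_in[OF x(2)] by blast
    have "upper X c \<le> l' x" using T'(2)[OF x(1)] lh by simp
    then show False using upp[OF x(2)] nontriv rf[OF xE] by auto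
  next
    case False
    then obtain x where x: "swap X T' x c" "x = e \<or> swap X T e x"
      using swap_exchange_in[OF tree T'(1) e(1)] by blast
    have le: "h' x \<le> lower X c" using T'(2)[OF x(1)] lh by simp
    then have "x \<noteq> e" using e(2) pred[OF E(1)] by auto
    then have ex: "swap X T e x" using x by blast
    then have xE: "x \<in> edges X" using swap_in by blast
    then have lx: "lower X x \<le> lower X c" using le rf[OF xE] by auto
    \<comment> \<open>The same \<open>e\<close> violates the bound with \<open>x\<close>, so
      minimality of \<open>c\<close> makes the lower limits equal; then \<open>x\<close> was
      determined from the start, at a value below \<open>upper X e\<close>.\<close>
    then have "x \<in> ?S" using ex e(2) xE by auto
    then have "lower X c \<le> lower X x" by (rule c(2))
    then have "upper X x = lower X c" using le lx rf[OF xE] by auto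
    then show False using upp[OF ex] \<open>lower X c < upper X e\<close> by auto
  qed
qed

lemma upper_le_predicted:
  assumes "swap X T a b"
  shows "upper X a \<le> predicted X b"
proof (rule ccontr)
  assume "\<not> upper X a \<le> predicted X b"
  let ?S = "{a \<in> edges X. \<exists>b. swap X T a b \<and> predicted X b < upper X a}"
  have "finite ?S" by simp
  moreover have "a \<in> ?S" using assms swap_in[OF assms] \<open>\<not> upper X a \<le> predicted X b\<close> by auto
  ultimately obtain e where e: "e \<in> ?S" "\<And>x. x \<in> ?S \<Longrightarrow> upper X x \<le> upper X e"
    by (rule finite_obtain_max[of ?S a "upper X"]) blast
  then obtain c where c: "swap X T e c" "predicted X c < upper X e" by blast
  have E: "e \<in> edges X" "c \<in> edges X" using swap_in[OF c(1)] by auto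
  have gt: "lower X c < upper X e" using c predicted_bounds[OF E(2)] by linarith
  moreover have "lower X e \<le> lower X c" using low[OF c(1)] by linarith
  ultimately have nontriv: "lower X e < upper X e" by linarith
  obtain l' h' T' where ref: "refines (edges X) (lower X) (upper X) l' h'"
    and pred: "\<And>x. x \<in> edges X \<Longrightarrow> l' x \<le> predicted X x \<and> predicted X x \<le> h' x"
    and lh: "l' e = lower X e" "h' e = upper X e"
    and T': "spanning_tree X T'" "\<And>a b. swap X T' a b \<Longrightarrow> h' a \<le> l' b"
    using not_mandatory[OF free E(1)] by metis
  note rf = ref[unfolded refines_def, rule_format]
  show False
  proof (cases "e \<in> T'")
    case False
    then obtain x where x: "swap X T e x" "swap X T' x e"
      using symmetric_exchange[OF tree T'(1)] c by (auto simp: swap_def)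
    have xE: "x \<in> edges X" using swap_in[OF x(1)] by blast
    have "h' x \<le> lower X e" using T'(2)[OF x(2)] lh by simp
    then show False using low[OF x(1)] nontriv rf[OF xE] by auto
  next
    case True
    then obtain x where x: "swap X T' e x" "x = c \<or> swap X T x c"
      using swap_exchange_out[OF tree T'(1) c(1)] by blast
    have ge: "upper X e \<le> l' x" using T'(2)[OF x(1)] lh by simp
    then have "x \<noteq> c" using c(2) pred[OF E(2)] by auto
    then have xc: "swap X T x c" using x by blast
    then have xE: "x \<in> edges X" using swap_in by blast
    then have ux: "upper X e \<le> upper X x" using ge rf[OF xE] by auto
    then have "x \<in> ?S" using xc c(2) xE by auto
    then have "upper X x \<le> upper X e" by (rule e(2))
    then have "lower X x = upper X e" using ge ux rf[OF xE] by auto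
    then show False using low[OF xc] gt by auto
  qed
qed

text \<open>The two trees give \<open>lower X a \<le> lower X b < upper X a \<le> upper X b\<close>.
  Thus no member of an overlapping pair is lost when determined edges are dropped.\<close>

lemma overlapping_nontrivial:
  assumes "swap X T a b" "lower X b < upper X a"
  shows "lower X a < upper X a" "lower X b < upper X b"
  using low[OF assms(1)] upp[OF assms(1)] assms(2) by auto

text \<open>The order of the queries matters: covered tree edges come first, by decreasing upper limit,
  then covered non-tree edges, by increasing lower limit. While the predictions hold, \<open>T\<close> stays a
  lower (first phase) or upper (second phase) limit tree, so the next edge and its partner are a
  witness set.\<close>

lemma cover_step:
  assumes cover: "vertex_cover {(a, b). swap X T a b \<and> lower X b < upper X a} A B"
    and f: "\<And>a. a \<in> A \<Longrightarrow> swap X T a (f a) \<and> lower X (f a) < upper X a \<and> f a \<notin> B"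
    and g: "\<And>b. b \<in> B \<Longrightarrow> swap X T (g b) b \<and> lower X b < upper X (g b) \<and> g b \<notin> A"
    and dom: "dom r \<subseteq> A \<union> B" "A \<subseteq> dom r \<or> dom r \<subseteq> A"
    and pred: "\<And>x. x \<in> dom r \<Longrightarrow> r x = Some (predicted X x)"
    and n: "\<not> certified X r T"
  obtains e where "e \<in> A - dom r" "dom r \<subseteq> A" "witness X r {e, f e}"
    | b where "b \<in> B - dom r" "A \<subseteq> dom r" "witness X r {b, g b}"
proof -
  have AT: "A \<subseteq> T" using f by (auto simp: swap_def)
  have BT: "B \<inter> T = {}" using g by (auto simp: swap_def)
  have fin: "finite A" "finite B" using cover by (auto simp: vertex_cover_def)
  have disjoint: "upper X a \<le> lower X b" if "swap X T a b" "a \<notin> A" "b \<notin> B" for a b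
    using cover that unfolding vertex_cover_def by fastforce
  have AE: "A \<subseteq> edges X" and BE: "B \<subseteq> edges X" using f g swap_in by blast+
  have domE: "dom r \<subseteq> edges X" using dom(1) AE BE by blast
  have known: "lo X r x = predicted X x" "hi X r x = predicted X x" if "x \<in> dom r" for x
    using pred[OF that] by (simp_all add: lo_hi_known)
  note unknown = lo_hi_unknown[of _ r X]
  have swapT: "a \<in> T" "b \<notin> T" if "swap X T a b" for a b using that by (auto simp: swap_def)
  show ?thesis
  proof (cases "A \<subseteq> dom r")
    case False
    then have domA: "dom r \<subseteq> A" using dom(2) by blast
    obtain e0 where "e0 \<in> A - dom r" using False by blast
    then obtain e where e: "e \<in> A - dom r" "\<And>x. x \<in> A - dom r \<Longrightarrow> upper X x \<le> upper X e"
      using finite_obtain_max[of "A - dom r" e0 "upper X"] fin(1) by blast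
    have s: "swap X T e (f e)" "lower X (f e) < upper X e" "f e \<notin> B" using f e(1) by auto
    have hi_e: "hi X r e = upper X e" using unknown(2) e(1) by blast
    have fe: "f e \<notin> dom r" using swapT[OF s(1)] domA AT by blast
    \<comment> \<open>Only tree edges are revealed so far. Such an \<open>a\<close> has value
      \<open>predicted X a\<close>, at most \<open>lower X b\<close>, and may tie because it is now
      determined.\<close>
    have "lower_tree X (lo X r) (hi X r) T" unfolding lower_tree_def
    proof (intro conjI allI impI)
      fix a b assume ab: "swap X T a b"
      have b: "b \<notin> dom r" using swapT[OF ab] domA AT by blast
      show "lo X r a < lo X r b \<or>
          lo X r a = lo X r b \<and> (lo X r a = hi X r a \<or> lo X r b < hi X r b)"
        using predicted_le_lower[OF ab] low[OF ab] known[of a] unknown[of a] unknown[OF b]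
        by (cases "a \<in> dom r") auto
    qed (rule tree)
    \<comment> \<open>On the cycle of \<open>f e\<close>, revealed edges are at most
      \<open>lower X (f e)\<close>, unrevealed covered ones are bounded by the choice of
      \<open>e\<close>, and uncovered ones do not overlap \<open>f e\<close>, which is itself
      uncovered.\<close>
    moreover have "hi X r a \<le> hi X r e" if a: "swap X T a (f e)" for a
    proof (cases "a \<in> dom r")
      case True
      then show ?thesis using predicted_le_lower[OF a] s(2) known(2)[OF True] hi_e by linarith
    next
      case False
      have "upper X a \<le> upper X e"
      proof (cases "a \<in> A")
        case True
        then show ?thesis using e(2)[of a] False by blast
      next
        case False
        then show ?thesis using disjoint[OF a False s(3)] s(2) by linarith
      qed
      then show ?thesis using unknown(2)[OF False] hi_e by simp
    qed
    ultimately have "witness X r {x \<in> {e, f e}. lo X r x < hi X r x}"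
      using s e(1) fe unknown by (intro lower_tree_witness_pair[OF domE]) auto
    moreover have "{x \<in> {e, f e}. lo X r x < hi X r x} = {e, f e}"
      using overlapping_nontrivial[OF s(1,2)] hi_e unknown(1)[of e] unknown[OF fe] e(1) by auto
    ultimately show ?thesis using that(1) e(1) domA by simp
  next
    case True
    \<comment> \<open>Once the whole cover is revealed, a covered \<open>a\<close> is settled by
      \<open>predicted_le_lower\<close>, a covered \<open>b\<close> by
      \<open>upper_le_predicted\<close>, and two uncovered edges do not overlap. So an unrevealed
      edge of \<open>B\<close> must be left.\<close>
    have certified: "certified X r T" if "B \<subseteq> dom r" unfolding certified_def
    proof (intro conjI allI impI)
      fix a b assume ab: "swap X T a b"
      note E = swap_in[OF ab]
      have a: "a \<in> dom r \<longleftrightarrow> a \<in> A" using True dom(1) BT swapT[OF ab] by blast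
      have b: "b \<in> dom r \<longleftrightarrow> b \<in> B" using \<open>B \<subseteq> dom r\<close> dom(1) AT swapT[OF ab] by blast
      show "hi X r a \<le> lo X r b"
        using predicted_le_lower[OF ab] upper_le_predicted[OF ab] disjoint[OF ab] a b
          known[of a] known[of b] unknown[of a] unknown[of b]
          predicted_bounds[of a] predicted_bounds[of b] E
        by (cases "a \<in> A"; cases "b \<in> B") auto
    qed (rule tree)
    then obtain b0 where "b0 \<in> B - dom r" using n by blast
    then obtain b where b: "b \<in> B - dom r" "\<And>x. x \<in> B - dom r \<Longrightarrow> lower X b \<le> lower X x"
      using finite_obtain_min[of "B - dom r" b0 "lower X"] fin(2) by blast
    have s: "swap X T (g b) b" "lower X b < upper X (g b)" "g b \<notin> A" using g b(1) by auto
    have lo_b: "lo X r b = lower X b" using unknown(1) b(1) by blast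
    have gb: "g b \<notin> dom r" using swapT[OF s(1)] dom(1) BT s(3) by blast
    \<comment> \<open>A revealed non-tree edge \<open>y\<close> is at least \<open>upper X x\<close>
      and may tie because it is determined; revealing a tree edge only lowers its
      \<open>hi\<close>.\<close>
    have "upper_tree X (lo X r) (hi X r) T" unfolding upper_tree_def
    proof (intro conjI allI impI)
      fix x y assume xy: "swap X T x y"
      note E = swap_in[OF xy]
      show "hi X r x < hi X r y \<or>
          hi X r x = hi X r y \<and> (lo X r x < hi X r x \<or> lo X r y = hi X r y)"
        using predicted_le_lower[OF xy] upper_le_predicted[OF xy] upp[OF xy]
          known[of x] known[of y] unknown[of x] unknown[of y]
          predicted_bounds[of x] predicted_bounds[of y] E
        by (cases "x \<in> dom r"; cases "y \<in> dom r") auto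
    qed (rule tree)
    moreover have "lo X r b \<le> lo X r y" if y: "swap X T (g b) y" for y
    proof (cases "y \<in> dom r")
      case True
      then show ?thesis using upper_le_predicted[OF y] s(2) known(1)[OF True] lo_b by linarith
    next
      case False
      have "lower X b \<le> lower X y"
      proof (cases "y \<in> B")
        case True
        then show ?thesis using b(2)[of y] False by blast
      next
        case False
        then show ?thesis using disjoint[OF y s(3) False] s(2) by linarith
      qed
      then show ?thesis using unknown(1)[OF False] lo_b by simp
    qed
    ultimately have "witness X r {x \<in> {g b, b}. lo X r x < hi X r x}"
      using s b(1) gb unknown by (intro upper_tree_witness_pair[OF domE]) auto
    moreover have "{x \<in> {g b, b}. lo X r x < hi X r x} = {b, g b}"
      using overlapping_nontrivial[OF s(1,2)] lo_b unknown(2)[of b] unknown[OF gb] b(1) by auto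
    ultimately show ?thesis using that(2) b(1) True by simp
  qed
qed

end

end

section \<open>The algorithm\<close>

lemma revealed_insert: "revealed w (insert e Q) = (revealed w Q)(e \<mapsto> w e)"
  by (auto simp: revealed_def)

lemma disjnt_pairs:
  assumes "inj_on h C" "\<And>x. x \<in> C \<Longrightarrow> h x \<notin> C"
  shows "pairwise disjnt ((\<lambda>x. {x, h x}) ` C)" "inj_on (\<lambda>x. {x, h x}) C"
proof -
  have "disjnt {x, h x} {y, h y}" if "x \<in> C" "y \<in> C" "x \<noteq> y" for x y
    using assms that by (auto simp: disjnt_def inj_on_def)
  then show "pairwise disjnt ((\<lambda>x. {x, h x}) ` C)"
    by (simp only: pairwise_image) (simp add: pairwise_def)
  show "inj_on (\<lambda>x. {x, h x}) C"
  proof (rule inj_onI)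
    fix x y assume "x \<in> C" "y \<in> C" "{x, h x} = {y, h y}"
    then show "x = y" using assms(2) by (metis doubleton_eq_iff)
  qed
qed

context uncertain_mst
begin

text \<open>An invariant replaces an explicit program: the strategy picks any edge after which
  \<open>P\<close> survives every possible answer. Each query is new, so the run ends. Only the
  value \<open>A X\<close> matters, which lets strategies for different inputs be glued
  together.\<close>

lemma adaptive_run:
  assumes init: "P Map.empty"
    and step: "\<And>r. P r \<Longrightarrow> dom r \<subseteq> edges X \<Longrightarrow> \<not> done r \<Longrightarrow>
      \<exists>e\<in>edges X - dom r. \<forall>y\<in>interval X e. P (r(e \<mapsto> y))"
  obtains a where "\<And>A w. A X = a \<Longrightarrow> in_intervals X w \<Longrightarrow>
    \<exists>Q. Q \<subseteq> edges X \<and> final_queries A X w Q \<and> P (revealed w Q) \<and> done (revealed w Q)"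
proof -
  let ?good = "\<lambda>r e. e \<in> edges X - dom r \<and> (\<forall>y\<in>interval X e. P (r(e \<mapsto> y)))"
  define a where "a r = (if done r then None else Some (SOME e. ?good r e))" for r
  have "\<exists>Q. Q \<subseteq> edges X \<and> final_queries A X w Q \<and> P (revealed w Q) \<and> done (revealed w Q)"
    if A: "A X = a" and w: "in_intervals X w" for A w
  proof -
    have "\<exists>Q'. Q' \<subseteq> edges X \<and> final_queries A X w Q' \<and> P (revealed w Q') \<and> done (revealed w Q')"
      if "queried A X w Q" "P (revealed w Q)" "Q \<subseteq> edges X" for Q
      using that
    proof (induction "card (edges X - Q)" arbitrary: Q rule: less_induct)
      case less
      show ?case
      proof (cases "done (revealed w Q)")
        case True
        then have "final_queries A X w Q" using less.prems A by (simp add: final_queries_def a_def)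
        then show ?thesis using less.prems True by blast
      next
        case False
        define e where "e = (SOME e. ?good (revealed w Q) e)"
        have "\<exists>e. ?good (revealed w Q) e" using step[OF less.prems(2)] less.prems(3) False by auto
        then have e: "?good (revealed w Q) e" unfolding e_def by (rule someI_ex)
        then have eE: "e \<in> edges X - Q" by simp
        have "A X (revealed w Q) = Some e" using A False by (simp add: a_def e_def)
        then have q: "queried A X w (insert e Q)" using less.prems(1) eE by (intro queried.query)
        have "w e \<in> interval X e" using w eE by (simp add: in_intervals_def)
        then have p: "P (revealed w (insert e Q))" using e by (simp add: revealed_insert)
        have "edges X - insert e Q \<subset> edges X - Q" using eE by blast
        then have "card (edges X - insert e Q) < card (edges X - Q)"
          by (intro psubset_card_mono) simp_all
        then show ?thesis using less.hyps[OF _ q p] less.prems(3) eE by blast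
      qed
    qed
    moreover have "queried A X w {}" by (rule queried.start)
    moreover have "revealed w {} = Map.empty" by (auto simp: revealed_def)
    ultimately show ?thesis using init by (metis empty_subsetI)
  qed
  then show ?thesis by (rule that)
qed

section \<open>Packings of small witness sets and the bounds they give\<close>

definition packing :: "('e \<rightharpoonup> real) \<Rightarrow> 'e set set \<Rightarrow> bool" where
  "packing r \<W> \<longleftrightarrow> pairwise disjnt \<W> \<and>
     (\<forall>W\<in>\<W>. witness X r W \<and> finite W \<and> card W \<le> 2 \<and> W \<subseteq> edges X)"

lemma packing_mono: "packing r \<W> \<Longrightarrow> r \<subseteq>\<^sub>m r' \<Longrightarrow> packing r' \<W>"
  unfolding packing_def using witness_mono[of X r _ r'] by simp

text \<open>Earlier members must be queried completely: a set of unrevealed edges is then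
  automatically disjoint from them.\<close>

lemma packing_insert:
  assumes "packing r \<W>" "\<Union>\<W> \<subseteq> dom r"
    and "W \<subseteq> edges X - dom r" "finite W" "card W \<le> 2" "witness X r W"
  shows "packing r (insert W \<W>)"
proof -
  have "disjnt W V \<and> disjnt V W" if "V \<in> \<W>" for V
    using that assms(2,3) by (auto simp: disjnt_def)
  then show ?thesis using assms unfolding packing_def pairwise_insert by blast
qed

lemma packing_le_opt:
  assumes "packing (revealed w Q) \<W>" and w: "in_intervals X w" and Q: "feasible X w Q"
  shows "finite \<W> \<and> card \<W> \<le> opt X w"
proof -
  have "\<exists>Q'. feasible X w Q' \<and> card Q' = opt X w"
    unfolding opt_def using LeastI[of "\<lambda>k. \<exists>Q. feasible X w Q \<and> card Q = k"] Q by blast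
  then obtain Q' where Q': "feasible X w Q'" "card Q' = opt X w" by blast
  have "Q' \<inter> W \<noteq> {}" if "W \<in> \<W>" for W
  proof -
    have "witness X (revealed w Q) W" using assms(1) that by (simp add: packing_def)
    moreover have "\<forall>e\<in>dom (revealed w Q). revealed w Q e = Some (w e)"
      by (simp only: dom_revealed) (simp add: revealed_def)
    ultimately show ?thesis using w Q'(1) unfolding witness_def by blast
  qed
  moreover have "finite Q'"
    using Q'(1) finite_edges finite_subset unfolding feasible_def by metis
  ultimately show ?thesis
    using card_witnesses_le[of Q' \<W>] assms(1) Q'(2) by (simp add: packing_def)
qed

lemma card_Union_packing:
  assumes "packing r \<W>" "finite \<W>"
  shows "card (\<Union>\<W>) \<le> 2 * card \<W>"
proof -
  have "card (\<Union>\<W>) \<le> sum card \<W>" by (rule card_Union_le_sum_card)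
  also have "\<dots> \<le> sum (\<lambda>_. 2) \<W>" using assms by (intro sum_mono) (simp add: packing_def)
  finally show ?thesis by simp
qed

lemma algorithm_exists:
  assumes free: "prediction_mandatory_free X"
    and low_tree: "lower_tree X (lower X) (upper X) T"
    and upp_tree: "upper_tree X (lower X) (upper X) T"
  obtains a where "\<And>A w. A X = a \<Longrightarrow> in_intervals X w \<Longrightarrow>
    \<exists>Q. final_queries A X w Q \<and> feasible X w Q \<and> card Q \<le> 2 * opt X w \<and>
      ((\<forall>e\<in>edges X. predicted X e = w e) \<longrightarrow> card Q \<le> opt X w)"
proof -
  have swap_in: "a \<in> edges X \<and> b \<in> edges X" if "swap X T a b" for a b
    using swap_edges[OF _ that] low_tree by (simp add: lower_tree_def)
  let ?R = "{(a, b). swap X T a b \<and> lower X b < upper X a}"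
  have "?R \<subseteq> edges X \<times> edges X" using swap_in by blast
  then have "finite ?R" by (rule finite_subset) simp
  from koenig[OF this] obtain A B f g where cover: "vertex_cover ?R A B"
    and f: "inj_on f A" "\<And>a. a \<in> A \<Longrightarrow> (a, f a) \<in> ?R \<and> f a \<notin> B"
    and g: "inj_on g B" "\<And>b. b \<in> B \<Longrightarrow> (g b, b) \<in> ?R \<and> g b \<notin> A" by blast
  have AT: "A \<subseteq> T" "\<And>a. a \<in> A \<Longrightarrow> f a \<notin> T" using f(2) by (auto simp: swap_def)
  have BT: "B \<inter> T = {}" "\<And>b. b \<in> B \<Longrightarrow> g b \<in> T" using g(2) by (auto simp: swap_def)
  \<comment> \<open>\<open>A\<close> lies inside \<open>T\<close> and \<open>B\<close> outside, so
    membership in \<open>T\<close> selects the right matching.\<close>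
  define h where "h x = (if x \<in> T then f x else g x)" for x
  have hA: "h x = f x" if "x \<in> A" for x using that AT(1) by (auto simp: h_def)
  have hB: "h x = g x" if "x \<in> B" for x using that BT(1) by (auto simp: h_def)
  have h_out: "h x \<notin> A \<union> B" if "x \<in> A \<union> B" for x
    using that f(2)[of x] g(2)[of x] AT BT hA hB by (metis IntI UnE emptyE subsetD)
  have h_inj: "inj_on h (A \<union> B)"
  proof (rule inj_onI)
    fix x y assume "x \<in> A \<union> B" "y \<in> A \<union> B" "h x = h y"
    then show "x = y"
      using inj_onD[OF f(1), of x y] inj_onD[OF g(1), of x y] hA hB AT(2) BT(2) by (metis UnE)
  qed
  have h_edges: "{x, h x} \<subseteq> edges X" if "x \<in> A \<union> B" for x
    using that f(2)[of x] g(2)[of x] hA[of x] hB[of x] swap_in by auto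

  \<comment> \<open>The comparability of \<open>A\<close> and \<open>dom r\<close> records that all
    covered tree edges precede the covered non-tree edges.\<close>
  define on_track where "on_track r \<longleftrightarrow> dom r \<subseteq> A \<union> B \<and> (A \<subseteq> dom r \<or> dom r \<subseteq> A) \<and>
    (\<forall>x\<in>dom r. r x = Some (predicted X x) \<and> witness X r {x, h x})" for r
  \<comment> \<open>The packing charges every query to a witness set of at most two edges; the
    recorded wrong answer means that only the factor 2 remains to be shown.\<close>
  define off_track where "off_track r \<longleftrightarrow> (\<exists>x\<in>dom r. r x \<noteq> Some (predicted X x)) \<and>
    (\<exists>\<W>. packing r \<W> \<and> dom r \<subseteq> \<Union>\<W>)" for r
  have pairs: "packing r ((\<lambda>x. {x, h x}) ` S)" "card ((\<lambda>x. {x, h x}) ` S) = card S"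
    if S: "S \<subseteq> A \<union> B" "\<And>x. x \<in> S \<Longrightarrow> witness X r {x, h x}" for r S
  proof -
    have "inj_on h S" "\<And>x. x \<in> S \<Longrightarrow> h x \<notin> S"
      using inj_on_subset[OF h_inj S(1)] h_out S(1) by blast+
    note disj = disjnt_pairs[OF this]
    show "packing r ((\<lambda>x. {x, h x}) ` S)" unfolding packing_def
    proof (intro conjI ballI)
      fix W assume "W \<in> (\<lambda>x. {x, h x}) ` S"
      then obtain x where x: "x \<in> S" "W = {x, h x}" by blast
      show "witness X r W" "finite W" "card W \<le> 2" using x S by (auto simp: card_insert_if)
      show "W \<subseteq> edges X" using x S h_edges by blast
    qed (rule disj(1))
    show "card ((\<lambda>x. {x, h x}) ` S) = card S" by (rule card_image[OF disj(2)])
  qed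

  obtain a where a: "\<And>A w. A X = a \<Longrightarrow> in_intervals X w \<Longrightarrow>
    \<exists>Q. Q \<subseteq> edges X \<and> final_queries A X w Q \<and> (on_track (revealed w Q) \<or> off_track (revealed w Q)) \<and>
      (\<exists>T'. certified X (revealed w Q) T')"
  proof (rule adaptive_run[of "\<lambda>r. on_track r \<or> off_track r" "\<lambda>r. \<exists>T'. certified X r T'"])
    show "on_track Map.empty \<or> off_track Map.empty" by (simp add: on_track_def)
  next
    fix r assume r: "on_track r \<or> off_track r" "dom r \<subseteq> edges X" "\<not> (\<exists>T'. certified X r T')"
    from r(1) show "\<exists>e\<in>edges X - dom r. \<forall>y\<in>interval X e.
        on_track (r(e \<mapsto> y)) \<or> off_track (r(e \<mapsto> y))"
    proof
      assume on: "on_track r"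
      then have dom: "dom r \<subseteq> A \<union> B" "A \<subseteq> dom r \<or> dom r \<subseteq> A"
        and pred: "\<And>x. x \<in> dom r \<Longrightarrow> r x = Some (predicted X x)"
        and wit: "\<And>x. x \<in> dom r \<Longrightarrow> witness X r {x, h x}" by (auto simp: on_track_def)
      obtain e where e: "e \<in> A \<union> B - dom r" "witness X r {e, h e}"
        "A \<subseteq> insert e (dom r) \<or> insert e (dom r) \<subseteq> A"
      proof (rule cover_step[OF free low_tree upp_tree cover _ _ dom pred, of f g])
        show "swap X T a (f a) \<and> lower X (f a) < upper X a \<and> f a \<notin> B" if "a \<in> A" for a
          using f(2)[OF that] by simp
        show "swap X T (g b) b \<and> lower X b < upper X (g b) \<and> g b \<notin> A" if "b \<in> B" for b
          using g(2)[OF that] by simp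
        show "\<not> certified X r T" using r(3) by blast
      next
        fix e assume "e \<in> A - dom r" "dom r \<subseteq> A" "witness X r {e, f e}"
        then show ?thesis using that[of e] hA[of e] by auto
      next
        fix b assume "b \<in> B - dom r" "A \<subseteq> dom r" "witness X r {b, g b}"
        then show ?thesis using that[of b] hB[of b] by auto
      qed
      have "on_track (r(e \<mapsto> y)) \<or> off_track (r(e \<mapsto> y))" for y
      proof -
        let ?r = "r(e \<mapsto> y)"
        have "r \<subseteq>\<^sub>m ?r" using e(1) by (auto simp: map_le_def)
        then have wit': "witness X ?r {x, h x}" if "x \<in> insert e (dom r)" for x
          using that e(2) wit witness_mono by blast
        show ?thesis
        proof (cases "y = predicted X e")
          case True
          then have "on_track ?r" using e dom(1) pred wit' by (auto simp: on_track_def)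
          then show ?thesis ..
        next
          case False
          \<comment> \<open>At the first wrong answer the pairs of all queried edges, the new one
            included, form a packing; their partners are its unqueried elements.\<close>
          have "packing ?r ((\<lambda>x. {x, h x}) ` insert e (dom r))"
            by (rule pairs) (use e(1) dom(1) wit' in auto)
          moreover have "dom ?r \<subseteq> \<Union> ((\<lambda>x. {x, h x}) ` insert e (dom r))" by auto
          moreover have "\<exists>x\<in>dom ?r. ?r x \<noteq> Some (predicted X x)" using False by auto
          ultimately show ?thesis unfolding off_track_def by blast
        qed
      qed
      moreover have "e \<in> edges X - dom r" using e(1) h_edges by blast
      ultimately show ?thesis by blast
    next
      assume off: "off_track r"
      then obtain \<W> where \<W>: "packing r \<W>" "dom r \<subseteq> \<Union>\<W>" by (auto simp: off_track_def)
      \<comment> \<open>A leftover edge of the packing supplies the next query; only an exhausted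
        packing is extended, as \<open>packing_insert\<close> demands.\<close>
      obtain \<V> e where \<V>: "packing r \<V>" "dom r \<subseteq> \<Union>\<V>" "e \<in> \<Union>\<V> - dom r"
      proof (cases "\<Union>\<W> \<subseteq> dom r")
        case False
        then show ?thesis using that \<W> by blast
      next
        case True
        obtain W where W: "W \<subseteq> edges X - dom r" "W \<noteq> {}" "finite W" "card W \<le> 2" "witness X r W"
          using witness_exists[OF r(2,3)] by blast
        have "packing r (insert W \<W>)" by (rule packing_insert[OF \<W>(1) True W(1,3,4,5)])
        moreover obtain e where "e \<in> W" "e \<notin> dom r" using W by blast
        ultimately show ?thesis using that[of "insert W \<W>" e] \<W>(2) by blast
      qed
      have "off_track (r(e \<mapsto> y))" for y
      proof -
        have "r \<subseteq>\<^sub>m r(e \<mapsto> y)" using \<V>(3) by (auto simp: map_le_def)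
        then have "packing (r(e \<mapsto> y)) \<V>" by (rule packing_mono[OF \<V>(1)])
        moreover have "dom (r(e \<mapsto> y)) \<subseteq> \<Union>\<V>" using \<V>(2,3) by simp
        moreover have "\<exists>x\<in>dom (r(e \<mapsto> y)). (r(e \<mapsto> y)) x \<noteq> Some (predicted X x)"
        proof -
          obtain x where x: "x \<in> dom r" "r x \<noteq> Some (predicted X x)"
            using off by (auto simp: off_track_def)
          then have "x \<noteq> e" using \<V>(3) by blast
          then show ?thesis using x by (intro bexI[of _ x]) auto
        qed
        ultimately show ?thesis unfolding off_track_def by blast
      qed
      moreover have "e \<in> edges X - dom r" using \<V>(1,3) by (auto simp: packing_def)
      ultimately show ?thesis by blast
    qed
  qed (rule that)
  show ?thesis
  proof (rule that[of a])
    fix A' :: "('v, 'e) query_algorithm" and w assume A': "A' X = a" and w: "in_intervals X w"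
    obtain Q where Q: "Q \<subseteq> edges X" "final_queries A' X w Q"
      "on_track (revealed w Q) \<or> off_track (revealed w Q)" "\<exists>T'. certified X (revealed w Q) T'"
      using a[of A' w, OF A' w] by blast
    have feas: "feasible X w Q" using feasible_iff[OF w] Q(1,4) by blast
    have "card Q \<le> 2 * opt X w \<and> ((\<forall>e\<in>edges X. predicted X e = w e) \<longrightarrow> card Q \<le> opt X w)"
    proof (cases "on_track (revealed w Q)")
      case True
      \<comment> \<open>Each query owns one pair, whose partner lies outside the cover and is never
        queried on track, so nothing is counted twice.\<close>
      then have "card Q \<le> opt X w"
        using pairs[of Q "revealed w Q"] packing_le_opt[OF _ w feas] unfolding on_track_def
        by (metis dom_revealed)
      then show ?thesis by simp
    next
      case False
      then have off: "off_track (revealed w Q)" using Q(3) by blast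
      then obtain \<W> where \<W>: "packing (revealed w Q) \<W>" "Q \<subseteq> \<Union>\<W>" by (auto simp: off_track_def)
      have fin: "finite \<W>" "card \<W> \<le> opt X w" using packing_le_opt[OF \<W>(1) w feas] by auto
      have "finite (\<Union>\<W>)" using \<W>(1) fin(1) by (auto simp: packing_def)
      then have "card Q \<le> card (\<Union>\<W>)" using \<W>(2) by (rule card_mono)
      also have "\<dots> \<le> 2 * card \<W>" by (rule card_Union_packing[OF \<W>(1) fin(1)])
      finally have "card Q \<le> 2 * opt X w" using fin(2) by simp
      moreover have "\<not> (\<forall>e\<in>edges X. predicted X e = w e)"
      proof -
        obtain x where x: "x \<in> Q" "revealed w Q x \<noteq> Some (predicted X x)"
          using off unfolding off_track_def dom_revealed by blast
        then have "predicted X x \<noteq> w x" by (simp add: revealed_def)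
        then show ?thesis using x(1) Q(1) by blast
      qed
      ultimately show ?thesis by blast
    qed
    then show "\<exists>Q. final_queries A' X w Q \<and> feasible X w Q \<and> card Q \<le> 2 * opt X w \<and>
        ((\<forall>e\<in>edges X. predicted X e = w e) \<longrightarrow> card Q \<le> opt X w)"
      using Q(2) feas by (intro exI[of _ Q]) simp
  qed
qed

end

theorem theorem4p3:
  shows "\<exists>A :: ('v, 'e) query_algorithm.
    consistent A {X. valid_input X \<and> prediction_mandatory_free X \<and> unique_equal_limit_trees X} 1 \<and>
    robust A {X. valid_input X \<and> prediction_mandatory_free X \<and> unique_equal_limit_trees X} 2"
proof -
  let ?C = "{X :: ('v, 'e) mst_input.
    valid_input X \<and> prediction_mandatory_free X \<and> unique_equal_limit_trees X}"
  \<comment> \<open>\<open>final_queries\<close> takes a whole algorithm, but \<open>a\<close> is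
    the strategy for one input. Quantifying over every \<open>A\<close> that agrees with
    \<open>a\<close> at \<open>X\<close> allows the choice function obtained below to be that
    algorithm.\<close>
  let ?spec = "\<lambda>X a. \<forall>(A :: ('v, 'e) query_algorithm) w. A X = a \<longrightarrow> in_intervals X w \<longrightarrow>
    (\<exists>Q. final_queries A X w Q \<and> feasible X w Q \<and> card Q \<le> 2 * opt X w \<and>
      ((\<forall>e\<in>edges X. predicted X e = w e) \<longrightarrow> card Q \<le> opt X w))"
  have "\<exists>a. ?spec X a" if X: "X \<in> ?C" for X
  proof -
    interpret uncertain_mst X by standard (use X in simp)
    obtain T where "{T'. lower_limit_tree X T'} = {T}" "{T'. upper_limit_tree X T'} = {T}"
      using X by (auto simp: unique_equal_limit_trees_def)
    then have "lower_limit_tree X T" "upper_limit_tree X T" by auto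
    then have T: "lower_tree X (lower X) (upper X) T" "upper_tree X (lower X) (upper X) T"
      using lower_limit_tree_imp upper_limit_tree_imp by blast+
    show ?thesis
    proof (rule algorithm_exists[OF _ T])
      show "prediction_mandatory_free X" using X by simp
    next
      fix a assume "\<And>A w. A X = a \<Longrightarrow> in_intervals X w \<Longrightarrow>
        \<exists>Q. final_queries A X w Q \<and> feasible X w Q \<and> card Q \<le> 2 * opt X w \<and>
          ((\<forall>e\<in>edges X. predicted X e = w e) \<longrightarrow> card Q \<le> opt X w)"
      then show ?thesis by (intro exI[of _ a] allI impI)
    qed
  qed
  then have "\<forall>X\<in>?C. \<exists>a. ?spec X a" by blast
  from bchoice[OF this] obtain A where A: "\<forall>X\<in>?C. ?spec X (A X)" ..
  have run: "\<exists>Q. final_queries A X w Q \<and> feasible X w Q \<and> card Q \<le> 2 * opt X w \<and>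
      ((\<forall>e\<in>edges X. predicted X e = w e) \<longrightarrow> card Q \<le> opt X w)"
    if "X \<in> ?C" "valid_weights X w" for X w
    using A[THEN bspec, OF that(1), rule_format, of A w, OF refl] that(2)
    by (simp add: valid_weights_def in_intervals_def)
  have "consistent A ?C 1" unfolding consistent_def competitive_on_def
  proof (intro ballI allI impI)
    fix X w assume X: "X \<in> ?C" and w: "valid_weights X w \<and> (\<forall>e\<in>edges X. predicted X e = w e)"
    from run[OF X] w obtain Q where
      "final_queries A X w Q" "feasible X w Q" "card Q \<le> opt X w" by blast
    then show "\<exists>Q. final_queries A X w Q \<and> feasible X w Q \<and> real (card Q) \<le> 1 * real (opt X w)"
      by (intro exI[of _ Q]) simp
  qed
  moreover have "robust A ?C 2" unfolding robust_def competitive_on_def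
  proof (intro ballI allI impI)
    fix X w assume X: "X \<in> ?C" and w: "valid_weights X w"
    from run[OF X w] obtain Q where
      "final_queries A X w Q" "feasible X w Q" "card Q \<le> 2 * opt X w" by blast
    then show "\<exists>Q. final_queries A X w Q \<and> feasible X w Q \<and> real (card Q) \<le> 2 * real (opt X w)"
      by (intro exI[of _ Q]) simp
  qed
  ultimately show ?thesis by blast
qed

end
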